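(* Let $\mathcal{V}$ be a strongly irregular variety and let $\mathbf{A}$ be an algebra in $R(\mathcal{V})$. Then $\mathbf{A}$ is free in $R(\mathcal{V})$ on the set of generators $\{a_j\}_{j\in J}$ if and only if $\mathbf{A}$ is the P\l onka sum over a semilattice direct system $\mathbb{A}=(\{\mathbf{A}_i\}_{i\in I},(I,\le),\{p_{ij}\}_{i\le j})$ such that: (1) $(I,\le)$ is the free semilattice with zero on the set of generators $J$; (2) for every $i\in I$, $\mathbf{A}_i$ is a finitely generated $\mathcal{V}$-free algebra. In particular, $\mathbf{A}_i$ has exactly $n$ generators $G^i=\{g^i_1,\dots,g^i_n\}$ if and only if $i=i_1\vee\dots\vee i_n$ for some $i_1,\dots,i_n\in J$ with $i_k\neq i_m$ for $k\neq m$; and if $i\in J$, then $\mathbf{A}_i$ is the free algebra generated by the element $g^i_1=a_{i_1}=a_i$; (3) for every $i\in I$, $p_{i_0i}$ is the unique homomorphism from $\mathbf{A}_{i_0}$ into $\mathbf{A}_i$, where $i_0$ is the least element of $I$; while for all $n\in\mathbb{N}^+$ and all $i_1,\dots,i_n\in J$, if $i=i_1\vee\dots\vee i_n$ then, for every $j\in\{1,\dots,n\}$, $p_{i_ji}\colon\mathbf{A}_{i_j}\to\mathbf{A}_i$ is the unique injective homomorphism extending the (injective) map $\{a_{i_j}\}\to\mathbf{A}_i$, $a_{i_j}\mapsto g^i_j$. In particular, for $i_0\neq i\le k$, $p_{ik}\colon\mathbf{A}_i\to\mathbf{A}_k$ is the unique injective homomorphism extending the (injective) map $G^i\to\mathbf{A}_k$,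 $g^i_j\mapsto g^k_j$.
   Context: All algebras are of a fixed plural type (one containing at least one operation symbol of arity at least $2$), possibly containing constant symbols. An identity is regular if the same variables occur on both sides. A variety $\mathcal{V}$ is strongly irregular if there is a binary term $f(x,y)$, in which both variables actually occur, such that $\mathcal{V}\models f(x,y)\approx x$. $R(\mathcal{V})$ is the variety satisfying exactly the regular identities holding in $\mathcal{V}$. A semilattice direct system $\mathbb{A}=(\{\mathbf{A}_i\}_{i\in I},(I,\le),\{p_{ij}\}_{i\le j})$ consists of a join-semilattice $(I,\le)$ with join $\vee$ and least element $i_0$, algebras $\mathbf{A}_i$ of the same type with pairwise disjoint universes, and homomorphisms $p_{ij}\colon\mathbf{A}_i\to\mathbf{A}_j$ for $i\le j$ with $p_{ii}=\mathrm{id}$ and $p_{ik}=p_{jk}\circ p_{ij}$ for $i\le j\le k$. Its P\l onka sum is the algebra with universe $\bigcup_{i\in I}A_i$ in which, for every $n$-ary operation $g$ with $n\ge1$ and $a_1\in A_{i_1},\dots,a_n\in A_{i_n}$, $g(a_1,\dots,a_n)=g^{\mathbf{A}_k}(p_{i_1k}(a_1),\dots,p_{i_nk}(a_n))$ with $k=i_1\vee\dots\vee i_n$, and every constant symbol $c$ of the type (if any) is interpreted as $c^{\mathbf{A}_{i_0}}$. An algebra is free in a variety (for $\mathcal{V}$: $\mathcal{V}$-free) on a set of generators if it belongs to the variety, is generated by that set, and has the universal mapping property for the variety over that set. The free semilattice with zero on $J$ is, up to isomorphism, the set of finite subsets of $J$ ordered by inclusion, with $j\in J$ identified with $\{j\}$.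 *)

theory Defs
  imports "HOL-Algebra.Lattice"
begin

section \<open>Algebras, terms and identities\<close>

text \<open>A similarity type is an arity function \<open>ar :: 'f \<Rightarrow> nat\<close>; constants are the symbols of arity
  \<open>0\<close>. Universes may be empty: if the type has no constants, the free algebra over the empty set
  is the empty algebra.\<close>

record ('f, 'a) algebra = "'a partial_object" +
  opr :: "'f \<Rightarrow> 'a list \<Rightarrow> 'a"

definition is_algebra :: "('f \<Rightarrow> nat) \<Rightarrow> ('f, 'a) algebra \<Rightarrow> bool" where
  "is_algebra ar A \<longleftrightarrow>
     (\<forall>f as. length as = ar f \<and> set as \<subseteq> carrier A \<longrightarrow> opr A f as \<in> carrier A)"

definition is_hom ::
  "('f \<Rightarrow> nat) \<Rightarrow> ('f, 'a) algebra \<Rightarrow> ('f, 'b) algebra \<Rightarrow> ('a \<Rightarrow> 'b) \<Rightarrow> bool" where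
  "is_hom ar A B h \<longleftrightarrow>
     (\<forall>a\<in>carrier A. h a \<in> carrier B) \<and>
     (\<forall>f as. length as = ar f \<and> set as \<subseteq> carrier A \<longrightarrow>
        h (opr A f as) = opr B f (map h as))"

inductive_set subuniverse_gen :: "('f \<Rightarrow> nat) \<Rightarrow> ('f, 'a) algebra \<Rightarrow> 'a set \<Rightarrow> 'a set"
  for ar A X where
  gen: "x \<in> X \<Longrightarrow> x \<in> subuniverse_gen ar A X"
| opr: "length as = ar f \<Longrightarrow> (\<And>a. a \<in> set as \<Longrightarrow> a \<in> subuniverse_gen ar A X) \<Longrightarrow>
        opr A f as \<in> subuniverse_gen ar A X"

datatype (dead 'f, vars: 'v) trm = Var 'v | Op 'f "('f, 'v) trm list"

primrec wf_trm :: "('f \<Rightarrow> nat) \<Rightarrow> ('f, 'v) trm \<Rightarrow> bool" where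
  "wf_trm ar (Var x) \<longleftrightarrow> True"
| "wf_trm ar (Op f ts) \<longleftrightarrow> length ts = ar f \<and> list_all (wf_trm ar) ts"

primrec eval :: "('f, 'a) algebra \<Rightarrow> ('v \<Rightarrow> 'a) \<Rightarrow> ('f, 'v) trm \<Rightarrow> 'a" where
  "eval A \<rho> (Var x) = \<rho> x"
| "eval A \<rho> (Op f ts) = opr A f (map (eval A \<rho>) ts)"

type_synonym 'f identity = "('f, nat) trm \<times> ('f, nat) trm"

definition is_identity :: "('f \<Rightarrow> nat) \<Rightarrow> 'f identity \<Rightarrow> bool" where
  "is_identity ar e \<longleftrightarrow> wf_trm ar (fst e) \<and> wf_trm ar (snd e)"

definition satisfies :: "('f, 'a) algebra \<Rightarrow> 'f identity \<Rightarrow> bool" where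
  "satisfies A e \<longleftrightarrow> (\<forall>\<rho>. range \<rho> \<subseteq> carrier A \<longrightarrow> eval A \<rho> (fst e) = eval A \<rho> (snd e))"

section \<open>Varieties\<close>

text \<open>A variety is given by a set \<open>E\<close> of defining identities.\<close>

definition in_variety :: "('f \<Rightarrow> nat) \<Rightarrow> 'f identity set \<Rightarrow> ('f, 'a) algebra \<Rightarrow> bool" where
  "in_variety ar E A \<longleftrightarrow> is_algebra ar A \<and> (\<forall>e\<in>E. satisfies A e)"

text \<open>HOL cannot quantify over all types inside a definition. Ranging over algebras whose elements
  have type \<open>('f, nat) trm\<close> is no restriction, by \<open>variety_satisfies_any_type\<close> below.\<close>

definition variety_satisfies :: "('f \<Rightarrow> nat) \<Rightarrow> 'f identity set \<Rightarrow> 'f identity \<Rightarrow> bool" where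
  "variety_satisfies ar E e \<longleftrightarrow>
     (\<forall>B :: ('f, ('f, nat) trm) algebra. in_variety ar E B \<longrightarrow> satisfies B e)"

text \<open>Variables \<open>0\<close> and \<open>1\<close> play the roles of \<open>x\<close> and \<open>y\<close>.\<close>

definition strongly_irregular :: "('f \<Rightarrow> nat) \<Rightarrow> 'f identity set \<Rightarrow> bool" where
  "strongly_irregular ar E \<longleftrightarrow>
     (\<exists>t. wf_trm ar t \<and> vars t = {0, 1} \<and> variety_satisfies ar E (t, Var 0))"

definition regular_identities :: "('f \<Rightarrow> nat) \<Rightarrow> 'f identity set \<Rightarrow> 'f identity set" where
  "regular_identities ar E =
     {e. is_identity ar e \<and> vars (fst e) = vars (snd e) \<and> variety_satisfies ar E e}"

section \<open>Free algebras\<close>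

text \<open>Freeness on a family \<open>(g x)\<^sub>x\<^sub>\<in>\<^sub>X\<close> of generators. The family is injective as soon as the variety
  has a member with two elements (\<open>free_on_inj\<close>), so only for trivial varieties does this differ
  from freeness on the set \<open>g ` X\<close>. As above, the type of the test algebras \<open>B\<close> is no
  restriction (\<open>free_on_ump\<close>).\<close>

definition free_on ::
  "('f \<Rightarrow> nat) \<Rightarrow> 'f identity set \<Rightarrow> ('f, 'a) algebra \<Rightarrow> 'x set \<Rightarrow> ('x \<Rightarrow> 'a) \<Rightarrow> bool" where
  "free_on ar E A X g \<longleftrightarrow>
     in_variety ar E A \<and>
     (\<forall>x\<in>X. g x \<in> carrier A) \<and>
     carrier A = subuniverse_gen ar A (g ` X) \<and>
     (\<forall>(B :: ('f, ('f, 'x) trm) algebra) \<phi>.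
        in_variety ar E B \<and> (\<forall>x\<in>X. \<phi> x \<in> carrier B) \<longrightarrow>
        (\<exists>h. is_hom ar A B h \<and> (\<forall>x\<in>X. h (g x) = \<phi> x) \<and>
             (\<forall>h'. is_hom ar A B h' \<and> (\<forall>x\<in>X. h' (g x) = \<phi> x) \<longrightarrow>
                   (\<forall>a\<in>carrier A. h' a = h a))))"

section \<open>Semilattice direct systems and Plonka sums\<close>

definition semilattice_with_zero :: "'i gorder \<Rightarrow> bool" where
  "semilattice_with_zero L \<longleftrightarrow> upper_semilattice L \<and> weak_partial_order_bottom L"

text \<open>The map \<open>\<iota>\<close> identifies the elements of \<open>J\<close> with elements of the semilattice.\<close>

definition free_semilattice_with_zero :: "'i gorder \<Rightarrow> 'j set \<Rightarrow> ('j \<Rightarrow> 'i) \<Rightarrow> bool" where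
  "free_semilattice_with_zero L J \<iota> \<longleftrightarrow>
     semilattice_with_zero L \<and>
     (\<exists>\<theta>. bij_betw \<theta> (carrier L) (Fpow J) \<and>
          (\<forall>x\<in>carrier L. \<forall>y\<in>carrier L. x \<sqsubseteq>\<^bsub>L\<^esub> y \<longleftrightarrow> \<theta> x \<subseteq> \<theta> y) \<and>
          (\<forall>j\<in>J. \<iota> j \<in> carrier L \<and> \<theta> (\<iota> j) = {j}))"

record ('i, 'f, 'a) direct_system =
  idx :: "'i gorder"
  cmp :: "'i \<Rightarrow> ('f, 'a) algebra"
  trans :: "'i \<Rightarrow> 'i \<Rightarrow> 'a \<Rightarrow> 'a"

definition semilattice_direct_system ::
  "('f \<Rightarrow> nat) \<Rightarrow> ('i, 'f, 'a) direct_system \<Rightarrow> bool" where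
  "semilattice_direct_system ar S \<longleftrightarrow>
     semilattice_with_zero (idx S) \<and>
     (\<forall>i\<in>carrier (idx S). is_algebra ar (cmp S i)) \<and>
     (\<forall>i\<in>carrier (idx S). \<forall>j\<in>carrier (idx S).
        i \<noteq> j \<longrightarrow> carrier (cmp S i) \<inter> carrier (cmp S j) = {}) \<and>
     (\<forall>i\<in>carrier (idx S). \<forall>j\<in>carrier (idx S).
        i \<sqsubseteq>\<^bsub>idx S\<^esub> j \<longrightarrow> is_hom ar (cmp S i) (cmp S j) (trans S i j)) \<and>
     (\<forall>i\<in>carrier (idx S). \<forall>a\<in>carrier (cmp S i). trans S i i a = a) \<and>
     (\<forall>i\<in>carrier (idx S). \<forall>j\<in>carrier (idx S). \<forall>k\<in>carrier (idx S).
        i \<sqsubseteq>\<^bsub>idx S\<^esub> j \<and> j \<sqsubseteq>\<^bsub>idx S\<^esub> k \<longrightarrow>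
        (\<forall>a\<in>carrier (cmp S i). trans S i k a = trans S j k (trans S i j a)))"

text \<open>In the second clause \<open>is\<close> lists the indices of the components that contain the arguments
  \<open>as\<close>.\<close>

definition is_plonka_sum ::
  "('f \<Rightarrow> nat) \<Rightarrow> ('i, 'f, 'a) direct_system \<Rightarrow> ('f, 'a) algebra \<Rightarrow> bool" where
  "is_plonka_sum ar S A \<longleftrightarrow>
     carrier A = (\<Union>i\<in>carrier (idx S). carrier (cmp S i)) \<and>
     (\<forall>f is as. ar f \<ge> 1 \<and> length as = ar f \<and> set is \<subseteq> carrier (idx S) \<and>
        list_all2 (\<lambda>i a. a \<in> carrier (cmp S i)) is as \<longrightarrow>
        (let k = \<Squnion>\<^bsub>idx S\<^esub> (set is)
         in opr A f as = opr (cmp S k) f (map2 (\<lambda>i a. trans S i k a) is as))) \<and>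
     (\<forall>f. ar f = 0 \<longrightarrow> opr A f [] = opr (cmp S \<bottom>\<^bsub>idx S\<^esub>) f [])"

definition is_unique_hom ::
  "('f \<Rightarrow> nat) \<Rightarrow> ('f, 'a) algebra \<Rightarrow> ('f, 'b) algebra \<Rightarrow> ('a \<Rightarrow> 'b) \<Rightarrow> bool" where
  "is_unique_hom ar A B p \<longleftrightarrow>
     is_hom ar A B p \<and> (\<forall>q. is_hom ar A B q \<longrightarrow> (\<forall>a\<in>carrier A. q a = p a))"

text \<open>\<open>p\<close> is the unique injective homomorphism \<open>A \<rightarrow> B\<close> extending \<open>u x \<mapsto> v x\<close>, \<open>x \<in> X\<close>.\<close>

definition is_unique_inj_hom_extending ::
  "('f \<Rightarrow> nat) \<Rightarrow> ('f, 'a) algebra \<Rightarrow> ('f, 'b) algebra \<Rightarrow>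
   'x set \<Rightarrow> ('x \<Rightarrow> 'a) \<Rightarrow> ('x \<Rightarrow> 'b) \<Rightarrow> ('a \<Rightarrow> 'b) \<Rightarrow> bool" where
  "is_unique_inj_hom_extending ar A B X u v p \<longleftrightarrow>
     is_hom ar A B p \<and> inj_on p (carrier A) \<and> (\<forall>x\<in>X. p (u x) = v x) \<and>
     (\<forall>q. is_hom ar A B q \<and> inj_on q (carrier A) \<and> (\<forall>x\<in>X. q (u x) = v x) \<longrightarrow>
          (\<forall>a\<in>carrier A. q a = p a))"

section \<open>Adequacy of the type restrictions\<close>

lemma eval_closed:
  assumes "is_algebra ar A" and "wf_trm ar t" and "\<forall>x\<in>vars t. \<rho> x \<in> carrier A"
  shows "eval A \<rho> t \<in> carrier A"
  using assms(2,3)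
proof (induction t)
  case (Op f ts)
  have "set (map (eval A \<rho>) ts) \<subseteq> carrier A"
    using Op by (auto simp: list_all_iff)
  then show ?case using Op.prems assms(1) unfolding is_algebra_def by simp
qed simp

lemma hom_eval:
  assumes "is_algebra ar A" and "is_hom ar A B h"
    and "wf_trm ar t" and "\<forall>x\<in>vars t. \<rho> x \<in> carrier A"
  shows "h (eval A \<rho> t) = eval B (h \<circ> \<rho>) t"
  using assms(3,4)
proof (induction t)
  case (Op f ts)
  have "set (map (eval A \<rho>) ts) \<subseteq> carrier A"
    using Op.prems by (auto simp: list_all_iff intro!: eval_closed[OF assms(1)])
  then have "h (eval A \<rho> (Op f ts)) = opr B f (map h (map (eval A \<rho>) ts))"
    using Op.prems assms(2) unfolding is_hom_def by simp
  also have "map h (map (eval A \<rho>) ts) = map (eval B (h \<circ> \<rho>)) ts"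
    using Op by (auto simp: list_all_iff comp_def)
  finally show ?case by (simp only: eval.simps)
qed simp

lemma inj_hom_satisfies:
  fixes A :: "('f, 'a) algebra" and B :: "('f, 'b) algebra"
  assumes "is_algebra ar A" and "is_hom ar A B h" and "inj_on h (carrier A)"
    and "is_identity ar e" and "satisfies B e"
  shows "satisfies A e"
  unfolding satisfies_def
proof (intro allI impI)
  fix \<rho> :: "nat \<Rightarrow> 'a" assume \<rho>: "range \<rho> \<subseteq> carrier A"
  have wf: "wf_trm ar (fst e)" "wf_trm ar (snd e)"
    using assms(4) unfolding is_identity_def by auto
  have B: "range (h \<circ> \<rho>) \<subseteq> carrier B"
    using \<rho> assms(2) unfolding is_hom_def by auto
  have "h (eval A \<rho> (fst e)) = h (eval A \<rho> (snd e))"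
  proof -
    have "\<forall>x. \<rho> x \<in> carrier A" using \<rho> by auto
    then have "h (eval A \<rho> t) = eval B (h \<circ> \<rho>) t" if "wf_trm ar t" for t
      using hom_eval[OF assms(1,2) that] by blast
    then show ?thesis using wf B assms(5) unfolding satisfies_def by simp
  qed
  moreover have "eval A \<rho> (fst e) \<in> carrier A" "eval A \<rho> (snd e) \<in> carrier A"
    using \<rho> wf by (auto intro!: eval_closed[OF assms(1)])
  ultimately show "eval A \<rho> (fst e) = eval A \<rho> (snd e)"
    using assms(3) by (auto dest: inj_onD)
qed

lemma small_copy:
  fixes B :: "('f, 'b) algebra" and \<phi> :: "'v \<Rightarrow> 'b"
  assumes E: "\<forall>e\<in>E. is_identity ar e" and B: "in_variety ar E B"
    and \<phi>: "\<forall>x\<in>X. \<phi> x \<in> carrier B"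
  obtains C :: "('f, ('f, 'v) trm) algebra" and e
  where "in_variety ar E C" "is_hom ar C B e" "inj_on e (carrier C)" "\<phi> ` X \<subseteq> e ` carrier C"
proof -
  define W where "W = {t. wf_trm ar t \<and> vars t \<subseteq> X}"
  define ev where "ev = eval B \<phi>"
  define r where "r = inv_into W ev"
  define C where "C = \<lparr>carrier = r ` ev ` W, opr = \<lambda>f ts. r (opr B f (map ev ts))\<rparr>"
  have algB: "is_algebra ar B" using B unfolding in_variety_def by auto
  have evr: "ev (r c) = c" if "c \<in> ev ` W" for c
    unfolding r_def using that by (rule f_inv_into_f)
  have CW: "carrier C \<subseteq> W"
    unfolding C_def r_def by (auto intro: inv_into_into)
  have evB: "ev t \<in> carrier B" if "t \<in> W" for t
    unfolding ev_def using that \<phi> unfolding W_def by (auto intro!: eval_closed[OF algB])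
  have op: "opr B f (map ev ts) \<in> ev ` W" if "length ts = ar f" "set ts \<subseteq> carrier C" for f ts
  proof -
    have "Op f ts \<in> W" using that CW unfolding W_def by (fastforce simp: list_all_iff)
    moreover have "ev (Op f ts) = opr B f (map ev ts)" unfolding ev_def by simp
    ultimately show ?thesis by force
  qed
  have algC: "is_algebra ar C"
    unfolding is_algebra_def using op by (auto simp: C_def)
  have hom: "is_hom ar C B ev"
    unfolding is_hom_def using op evr CW evB by (auto simp: C_def)
  have inj: "inj_on ev (carrier C)"
    unfolding C_def by (auto intro!: inj_onI simp: evr)
  have "in_variety ar E C"
    using inj_hom_satisfies[OF algC hom inj] E B algC unfolding in_variety_def by blast
  moreover have "\<phi> ` X \<subseteq> ev ` carrier C"
  proof
    fix b assume "b \<in> \<phi> ` X"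
    then obtain x where x: "x \<in> X" "b = \<phi> x" by auto
    then have "b = ev (Var x)" "Var x \<in> W" unfolding ev_def W_def by auto
    then have "b \<in> ev ` W" by blast
    then show "b \<in> ev ` carrier C" using evr by (auto simp: C_def image_iff)
  qed
  ultimately show thesis using that hom inj by blast
qed

theorem variety_satisfies_any_type:
  fixes B :: "('f, 'b) algebra"
  assumes E: "\<forall>e\<in>E. is_identity ar e" and e: "is_identity ar e"
    and V: "variety_satisfies ar E e" and B: "in_variety ar E B"
  shows "satisfies B e"
  unfolding satisfies_def
proof (intro allI impI)
  fix \<rho> :: "nat \<Rightarrow> 'b" assume \<rho>: "range \<rho> \<subseteq> carrier B"
  have "\<forall>x\<in>UNIV. \<rho> x \<in> carrier B" using \<rho> by auto
  then obtain C :: "('f, ('f, nat) trm) algebra" and h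
    where C: "in_variety ar E C" and hom: "is_hom ar C B h"
      and inj: "inj_on h (carrier C)" and sub: "\<rho> ` UNIV \<subseteq> h ` carrier C"
    by (rule small_copy[OF E B])
  define \<sigma> where "\<sigma> x = inv_into (carrier C) h (\<rho> x)" for x
  have "\<rho> x \<in> h ` carrier C" for x
    using sub by auto
  then have \<sigma>: "range \<sigma> \<subseteq> carrier C" "h \<circ> \<sigma> = \<rho>"
    unfolding \<sigma>_def by (auto intro!: inv_into_into f_inv_into_f ext simp: fun_eq_iff)
  have algC: "is_algebra ar C" using C unfolding in_variety_def by auto
  have "eval C \<sigma> (fst e) = eval C \<sigma> (snd e)"
    using V C \<sigma>(1) unfolding variety_satisfies_def satisfies_def by blast
  then show "eval B \<rho> (fst e) = eval B \<rho> (snd e)"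
  proof -
    assume eq: "eval C \<sigma> (fst e) = eval C \<sigma> (snd e)"
    have "\<forall>x. \<sigma> x \<in> carrier C" using \<sigma>(1) by auto
    then have "h (eval C \<sigma> t) = eval B \<rho> t" if "wf_trm ar t" for t
      using hom_eval[OF algC hom that] \<sigma>(2) by auto
    then show ?thesis using eq e unfolding is_identity_def by metis
  qed
qed

lemma hom_eq_on_gen:
  assumes "is_algebra ar A" and "is_hom ar A B h" and "is_hom ar A B h'"
    and "X \<subseteq> carrier A" and "\<forall>x\<in>X. h x = h' x" and "a \<in> subuniverse_gen ar A X"
  shows "a \<in> carrier A \<and> h a = h' a"
  using assms(6)
proof induction
  case (gen x)
  then show ?case using assms by auto
next
  case (opr as f)
  then have as: "set as \<subseteq> carrier A" "map h as = map h' as" by auto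
  moreover have "h (opr A f as) = opr B f (map h as)" "h' (opr A f as) = opr B f (map h' as)"
    using assms(2,3) opr(1) as(1) unfolding is_hom_def by simp_all
  ultimately have "h (opr A f as) = h' (opr A f as)" by (simp only:)
  then show ?case
    using assms(1) opr(1) as(1) unfolding is_algebra_def by blast
qed

theorem free_on_ump:
  fixes B :: "('f, 'b) algebra" and \<phi> :: "'x \<Rightarrow> 'b"
  assumes E: "\<forall>e\<in>E. is_identity ar e" and A: "free_on ar E A X g"
    and B: "in_variety ar E B" and \<phi>: "\<forall>x\<in>X. \<phi> x \<in> carrier B"
  shows "\<exists>h. is_hom ar A B h \<and> (\<forall>x\<in>X. h (g x) = \<phi> x) \<and>
             (\<forall>h'. is_hom ar A B h' \<and> (\<forall>x\<in>X. h' (g x) = \<phi> x) \<longrightarrow>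
                   (\<forall>a\<in>carrier A. h' a = h a))"
proof -
  obtain C :: "('f, ('f, 'x) trm) algebra" and e
    where C: "in_variety ar E C" and e: "is_hom ar C B e"
      and inj: "inj_on e (carrier C)" and sub: "\<phi> ` X \<subseteq> e ` carrier C"
    by (rule small_copy[OF E B \<phi>])
  define \<psi> where "\<psi> x = inv_into (carrier C) e (\<phi> x)" for x
  have \<psi>: "\<forall>x\<in>X. \<psi> x \<in> carrier C" "\<forall>x\<in>X. e (\<psi> x) = \<phi> x"
    using sub unfolding \<psi>_def by (auto intro!: inv_into_into f_inv_into_f)
  obtain h where h: "is_hom ar A C h" "\<forall>x\<in>X. h (g x) = \<psi> x"
    using A C \<psi>(1) unfolding free_on_def by blast
  have algA: "is_algebra ar A" and gA: "g ` X \<subseteq> carrier A"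
    and genA: "carrier A = subuniverse_gen ar A (g ` X)"
    using A unfolding free_on_def in_variety_def by auto
  have hom: "is_hom ar A B (e \<circ> h)"
    unfolding is_hom_def
  proof (intro conjI allI impI ballI)
    fix a assume "a \<in> carrier A"
    then show "(e \<circ> h) a \<in> carrier B" using h(1) e unfolding is_hom_def by auto
  next
    fix f as assume as: "length as = ar f \<and> set as \<subseteq> carrier A"
    then have "h (opr A f as) = opr C f (map h as)" "set (map h as) \<subseteq> carrier C"
      using h(1) unfolding is_hom_def by auto
    then show "(e \<circ> h) (opr A f as) = opr B f (map (e \<circ> h) as)"
      using as e unfolding is_hom_def by simp
  qed
  have ext: "\<forall>x\<in>X. (e \<circ> h) (g x) = \<phi> x" using h(2) \<psi>(2) by simp
  have "h' a = (e \<circ> h) a"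
    if "is_hom ar A B h'" "\<forall>x\<in>X. h' (g x) = \<phi> x" "a \<in> carrier A" for h' a
    using hom_eq_on_gen[OF algA that(1) hom gA] that ext genA by auto
  then show ?thesis using hom ext by blast
qed

lemma free_on_inj:
  fixes B :: "('f, 'b) algebra"
  assumes E: "\<forall>e\<in>E. is_identity ar e" and A: "free_on ar E A X g"
    and B: "in_variety ar E B" "b \<in> carrier B" "c \<in> carrier B" "b \<noteq> c"
  shows "inj_on g X"
proof (rule inj_onI)
  fix x y assume xy: "x \<in> X" "y \<in> X" "g x = g y"
  have "\<forall>z\<in>X. (if z = x then b else c) \<in> carrier B"
    using B by simp
  from free_on_ump[OF E A B(1) this]
  obtain h where "\<forall>z\<in>X. h (g z) = (if z = x then b else c)"
    by blast
  then show "x = y" using xy B(4) by metis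
qed

end

theory Submission
  imports Defs
begin

text \<open>Let \<open>t(x, y) \<approx> x\<close> witness strong irregularity. Multiplying a term by further variables via
  \<open>t\<close> does not change it modulo \<open>\<V>\<close>, but enlarges its set of variables at will. Hence two terms
  agree in the free algebra of \<open>R(\<V>)\<close> iff they agree modulo \<open>\<V>\<close> and have the same variables, and
  the terms whose set of variables is a given finite \<open>k \<subseteq> J\<close> represent all terms over \<open>k\<close> modulo
  \<open>\<V>\<close>. So the elements of the free algebra with set of variables \<open>k\<close> form the \<open>\<V>\<close>-free algebra on
  \<open>k\<close>, constants and generators being multiplied by all variables in \<open>k\<close>, and the same
  multiplication gives the transition maps. Conversely, in a Plonka sum as in the theorem a term
  with set of variables \<open>k\<close> takes its value in the \<open>\<V>\<close>-free component indexed by \<open>k\<close>, so that this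
  value determines both \<open>k\<close> and the term modulo \<open>\<V>\<close>.\<close>

section \<open>Terms and identities\<close>

primrec subst :: "('v \<Rightarrow> ('f, 'w) trm) \<Rightarrow> ('f, 'v) trm \<Rightarrow> ('f, 'w) trm" where
  "subst \<sigma> (Var x) = \<sigma> x"
| "subst \<sigma> (Op f ts) = Op f (map (subst \<sigma>) ts)"

lemma wf_subst:
  "wf_trm ar t \<Longrightarrow> (\<And>x. x \<in> vars t \<Longrightarrow> wf_trm ar (\<sigma> x)) \<Longrightarrow> wf_trm ar (subst \<sigma> t)"
  by (induction t) (auto simp: list_all_iff)

lemma vars_subst: "vars (subst \<sigma> t) = (\<Union>x\<in>vars t. vars (\<sigma> x))"
  by (induction t) auto

lemma eval_cong: "(\<And>x. x \<in> vars t \<Longrightarrow> \<rho> x = \<rho>' x) \<Longrightarrow> eval A \<rho> t = eval A \<rho>' t"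
proof (induction t)
  case (Op f ts)
  then have "map (eval A \<rho>) ts = map (eval A \<rho>') ts" by auto
  then show ?case by (simp only: eval.simps)
qed simp

lemma eval_subst: "eval A \<rho> (subst \<sigma> t) = eval A (\<lambda>x. eval A \<rho> (\<sigma> x)) t"
proof (induction t)
  case (Op f ts)
  then have "map (eval A \<rho>) (map (subst \<sigma>) ts) = map (eval A (\<lambda>x. eval A \<rho> (\<sigma> x))) ts"
    by simp
  then show ?case by (simp only: eval.simps subst.simps)
qed simp

lemma finite_vars: "finite (vars t)"
  by (induction t) auto

lemma subuniverse_gen_eval:
  "subuniverse_gen ar A (g ` X) = {eval A g s | s. wf_trm ar s \<and> vars s \<subseteq> X}"
proof (intro equalityI subsetI)
  fix x assume "x \<in> subuniverse_gen ar A (g ` X)"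
  then show "x \<in> {eval A g s | s. wf_trm ar s \<and> vars s \<subseteq> X}"
  proof induction
    case (gen x)
    then obtain y where "y \<in> X" "x = g y" by auto
    then show ?case by (auto intro!: exI[of _ "Var y"])
  next
    case (opr as f)
    then have "\<forall>a\<in>set as. \<exists>s. a = eval A g s \<and> wf_trm ar s \<and> vars s \<subseteq> X" by blast
    then obtain s where s: "\<And>a. a \<in> set as \<Longrightarrow> a = eval A g (s a) \<and> wf_trm ar (s a) \<and> vars (s a) \<subseteq> X"
      by metis
    then have "map (eval A g) (map s as) = as" by (simp add: map_idI)
    then have "opr A f as = eval A g (Op f (map s as))" by (simp only: eval.simps)
    then show ?case using s opr(1) by (fastforce simp: list_all_iff)
  qed
next
  have "eval A g s \<in> subuniverse_gen ar A (g ` X)" if "wf_trm ar s" "vars s \<subseteq> X" for s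
    using that
  proof (induction s)
    case (Op f ts)
    then have "a \<in> subuniverse_gen ar A (g ` X)" if "a \<in> set (map (eval A g) ts)" for a
      using that by (fastforce simp: list_all_iff)
    then show ?case
      using subuniverse_gen.opr[of "map (eval A g) ts" ar f] Op.prems by simp
  qed (auto intro: subuniverse_gen.gen)
  then show "x \<in> subuniverse_gen ar A (g ` X)"
    if "x \<in> {eval A g s | s. wf_trm ar s \<and> vars s \<subseteq> X}" for x
    using that by blast
qed

text \<open>The assignments are total, so that empty algebras impose no condition.\<close>

definition entails ::
  "('f \<Rightarrow> nat) \<Rightarrow> 'f identity set \<Rightarrow> ('f, 'v) trm \<Rightarrow> ('f, 'v) trm \<Rightarrow> bool" where
  "entails ar E s s' \<longleftrightarrow>
     (\<forall>(B :: ('f, ('f, nat) trm) algebra) \<rho>.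
        in_variety ar E B \<and> range \<rho> \<subseteq> carrier B \<longrightarrow> eval B \<rho> s = eval B \<rho> s')"

lemma entailsI:
  assumes "\<And>(B :: ('f, ('f, nat) trm) algebra) \<rho>.
    in_variety ar E B \<Longrightarrow> range \<rho> \<subseteq> carrier B \<Longrightarrow> eval B \<rho> s = eval B \<rho> s'"
  shows "entails ar E s s'"
  using assms unfolding entails_def by blast

lemma entails_identity: "entails ar E s s' \<longleftrightarrow> variety_satisfies ar E (s, s')"
  unfolding entails_def variety_satisfies_def satisfies_def by auto

lemma entails_subst:
  fixes s s' :: "('f, 'v) trm" and \<sigma> :: "'v \<Rightarrow> ('f, 'w) trm"
  assumes "entails ar E s s'" "\<And>x. wf_trm ar (\<sigma> x)"
  shows "entails ar E (subst \<sigma> s) (subst \<sigma> s')"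
proof (rule entailsI)
  fix B :: "('f, ('f, nat) trm) algebra" and \<rho> :: "'w \<Rightarrow> ('f, nat) trm"
  assume B: "in_variety ar E B" "range \<rho> \<subseteq> carrier B"
  then have "range (\<lambda>x. eval B \<rho> (\<sigma> x)) \<subseteq> carrier B"
    using assms(2) unfolding in_variety_def by (auto intro!: eval_closed)
  then show "eval B \<rho> (subst \<sigma> s) = eval B \<rho> (subst \<sigma> s')"
    using assms(1) B(1) unfolding entails_def eval_subst by blast
qed

text \<open>Identities have variables in \<open>nat\<close>, whereas terms over generators have
  variables in an arbitrary type. Two terms contain finitely many variables, so they can be renamed
  into \<open>nat\<close> reversibly.\<close>

lemma rename_to_nat:
  fixes s s' :: "('f, 'v) trm"
  shows "\<exists>(r :: 'v \<Rightarrow> nat) r'. \<forall>x\<in>vars s \<union> vars s'. r' (r x) = x"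
proof -
  have "finite (vars s \<union> vars s')" by (simp add: finite_vars)
  from finite_imp_inj_to_nat_seg[OF this]
  obtain r :: "'v \<Rightarrow> nat" where "inj_on r (vars s \<union> vars s')" by blast
  then have "\<forall>x\<in>vars s \<union> vars s'. inv_into (vars s \<union> vars s') r (r x) = x" by simp
  then show ?thesis by blast
qed

text \<open>Renaming turns the pair into an identity over \<open>nat\<close>, and
  \<open>variety_satisfies_any_type\<close> carries it to every type of elements. Only the values on
  occurring variables have to lie in \<open>B\<close>, as is natural for a family of
  generators.\<close>

lemma entails_eval:
  fixes B :: "('f, 'b) algebra" and s s' :: "('f, 'v) trm"
  assumes E: "\<forall>e\<in>E. is_identity ar e" and ent: "entails ar E s s'"
    and wf: "wf_trm ar s" "wf_trm ar s'"
    and B: "in_variety ar E B" and \<rho>: "\<And>x. x \<in> vars s \<union> vars s' \<Longrightarrow> \<rho> x \<in> carrier B"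
  shows "eval B \<rho> s = eval B \<rho> s'"
proof -
  obtain r :: "'v \<Rightarrow> nat" and r' where r: "\<forall>x\<in>vars s \<union> vars s'. r' (r x) = x"
    using rename_to_nat[of s s'] by blast
  define e where "e = (subst (Var \<circ> r) s, subst (Var \<circ> r) s')"
  have "entails ar E (fst e) (snd e)"
    unfolding e_def fst_conv snd_conv by (rule entails_subst[OF ent]) simp
  then have "variety_satisfies ar E e" by (simp add: entails_identity)
  moreover have "is_identity ar e"
    unfolding is_identity_def e_def using wf by (auto intro!: wf_subst)
  ultimately have sat: "satisfies B e"
    using variety_satisfies_any_type[OF E _ _ B] by blast
  have alg: "is_algebra ar B" using B unfolding in_variety_def by blast
  \<comment> \<open>\<open>satisfies\<close> speaks of assignments with all values in the carrier,
    so the remaining variables need a default \<open>d\<close>. It exists even if no variable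
    occurs: the value of \<open>s\<close> is itself an element.\<close>
  have "eval B \<rho> s \<in> carrier B" by (rule eval_closed[OF alg wf(1)]) (use \<rho> in auto)
  then obtain d where d: "d \<in> carrier B" by blast
  define \<rho>' where "\<rho>' n = (if \<rho> (r' n) \<in> carrier B then \<rho> (r' n) else d)" for n
  have "range \<rho>' \<subseteq> carrier B" unfolding \<rho>'_def using d by auto
  then have "eval B (\<lambda>x. \<rho>' (r x)) s = eval B (\<lambda>x. \<rho>' (r x)) s'"
    using sat unfolding satisfies_def e_def by (simp add: eval_subst)
  moreover have "eval B \<rho> s = eval B (\<lambda>x. \<rho>' (r x)) s" "eval B \<rho> s' = eval B (\<lambda>x. \<rho>' (r x)) s'"
    by (auto intro!: eval_cong simp: \<rho>'_def r \<rho>)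
  ultimately show ?thesis by simp
qed

section \<open>Freeness in terms of identities\<close>

text \<open>Every assignment of the generators into a member of the variety extends to a
  homomorphism, which carries an equality in \<open>A\<close> to that member. Conversely,
  \<open>A\<close> itself belongs to the variety.\<close>

lemma free_on_eval_iff:
  fixes A :: "('f, 'a) algebra" and s s' :: "('f, 'x) trm"
  assumes E: "\<forall>e\<in>E. is_identity ar e" and A: "free_on ar E A X g"
    and s: "wf_trm ar s" "vars s \<subseteq> X" and s': "wf_trm ar s'" "vars s' \<subseteq> X"
  shows "eval A g s = eval A g s' \<longleftrightarrow> entails ar E s s'"
proof
  have A': "in_variety ar E A" "\<And>x. x \<in> X \<Longrightarrow> g x \<in> carrier A" "is_algebra ar A"
    using A unfolding free_on_def in_variety_def by auto
  assume eq: "eval A g s = eval A g s'"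
  show "entails ar E s s'"
  proof (rule entailsI)
    fix B :: "('f, ('f, nat) trm) algebra" and \<rho> :: "'x \<Rightarrow> _"
    assume B: "in_variety ar E B" "range \<rho> \<subseteq> carrier B"
    then obtain h where h: "is_hom ar A B h" "\<And>x. x \<in> X \<Longrightarrow> h (g x) = \<rho> x"
      using free_on_ump[OF E A B(1), of \<rho>] by blast
    have "eval B \<rho> u = h (eval A g u)" if "wf_trm ar u" "vars u \<subseteq> X" for u
    proof -
      have "h (eval A g u) = eval B (h \<circ> g) u"
        using that A'(2) by (intro hom_eval[OF A'(3) h(1)]) auto
      also have "\<dots> = eval B \<rho> u"
        using that h(2) by (intro eval_cong) auto
      finally show ?thesis by simp
    qed
    then show "eval B \<rho> s = eval B \<rho> s'" using eq s s' by simp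
  qed
next
  assume "entails ar E s s'"
  then show "eval A g s = eval A g s'"
    using A s s' unfolding free_on_def by (intro entails_eval[OF E]) auto
qed

text \<open>Each element is the value of a term in the generators, so a homomorphism is obtained by
  evaluating a chosen term for it in the target. By \<open>ent\<close> the result does not depend on
  the choice, which also makes the map compatible with the operations.\<close>

lemma free_onI:
  fixes A :: "('f, 'a) algebra" and X :: "'x set"
  assumes E: "\<forall>e\<in>E. is_identity ar e" and A: "in_variety ar E A"
    and g: "\<And>x. x \<in> X \<Longrightarrow> g x \<in> carrier A" and gen: "carrier A \<subseteq> subuniverse_gen ar A (g ` X)"
    and ent: "\<And>s s'. wf_trm ar s \<Longrightarrow> vars s \<subseteq> X \<Longrightarrow> wf_trm ar s' \<Longrightarrow> vars s' \<subseteq> X \<Longrightarrow>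
      eval A g s = eval A g s' \<Longrightarrow> entails ar E s s'"
  shows "free_on ar E A X g"
proof -
  have alg: "is_algebra ar A" using A unfolding in_variety_def by blast
  have carr: "carrier A = {eval A g s | s. wf_trm ar s \<and> vars s \<subseteq> X}"
    using gen g unfolding subuniverse_gen_eval by (auto intro!: eval_closed[OF alg])
  have "\<exists>h. is_hom ar A B h \<and> (\<forall>x\<in>X. h (g x) = \<phi> x) \<and>
             (\<forall>h'. is_hom ar A B h' \<and> (\<forall>x\<in>X. h' (g x) = \<phi> x) \<longrightarrow> (\<forall>a\<in>carrier A. h' a = h a))"
    if B: "in_variety ar E B" and \<phi>: "\<forall>x\<in>X. \<phi> x \<in> carrier B"
    for B :: "('f, ('f, 'x) trm) algebra" and \<phi>
  proof -
    have algB: "is_algebra ar B" using B unfolding in_variety_def by blast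
    define rep where "rep x = (SOME s. wf_trm ar s \<and> vars s \<subseteq> X \<and> eval A g s = x)" for x
    have rep: "wf_trm ar (rep x)" "vars (rep x) \<subseteq> X" "eval A g (rep x) = x"
      if "x \<in> carrier A" for x
    proof -
      have "\<exists>s. wf_trm ar s \<and> vars s \<subseteq> X \<and> eval A g s = x" using that carr by auto
      from someI_ex[OF this]
      show "wf_trm ar (rep x)" "vars (rep x) \<subseteq> X" "eval A g (rep x) = x"
        unfolding rep_def by auto
    qed
    define h where "h x = eval B \<phi> (rep x)" for x
    have h_eval: "h (eval A g s) = eval B \<phi> s" if s: "wf_trm ar s" "vars s \<subseteq> X" for s
    proof -
      have c: "eval A g s \<in> carrier A" using s carr by auto
      show ?thesis unfolding h_def
        using rep[OF c] s \<phi> by (intro entails_eval[OF E ent _ _ B]) auto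
    qed
    have "is_hom ar A B h"
      unfolding is_hom_def
    proof (intro conjI ballI allI impI)
      show "h x \<in> carrier B" if "x \<in> carrier A" for x
        unfolding h_def using rep[OF that] \<phi> by (auto intro!: eval_closed[OF algB])
      fix f as assume as: "length as = ar f \<and> set as \<subseteq> carrier A"
      have "map (eval A g) (map rep as) = as"
        using as rep(3) by (auto intro!: map_idI)
      then have "opr A f as = eval A g (Op f (map rep as))" by (simp only: eval.simps)
      also have "h \<dots> = eval B \<phi> (Op f (map rep as))"
        using as rep by (intro h_eval) (fastforce simp: list_all_iff)+
      also have "\<dots> = opr B f (map h as)"
        by (simp add: h_def[abs_def] comp_def)
      finally show "h (opr A f as) = opr B f (map h as)" .
    qed
    moreover have "\<forall>x\<in>X. h (g x) = \<phi> x" using h_eval[of "Var _"] by simp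
    moreover have "h' a = h a"
      if "is_hom ar A B h'" "\<forall>x\<in>X. h' (g x) = \<phi> x" "a \<in> carrier A" for h' a
      using hom_eq_on_gen[OF alg that(1) \<open>is_hom ar A B h\<close>, of "g ` X" a] that g gen
        \<open>\<forall>x\<in>X. h (g x) = \<phi> x\<close> by auto
    ultimately show ?thesis by blast
  qed
  moreover have "carrier A = subuniverse_gen ar A (g ` X)"
    using carr by (simp only: subuniverse_gen_eval)
  ultimately show ?thesis unfolding free_on_def using A g by blast
qed

section \<open>Regular identities\<close>

lemma regular_identities_identity: "\<forall>e\<in>regular_identities ar E. is_identity ar e"
  unfolding regular_identities_def by blast

lemma in_variety_regular:
  assumes "\<forall>e\<in>E. is_identity ar e" "in_variety ar E B"
  shows "in_variety ar (regular_identities ar E) B"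
proof -
  have "satisfies B e" if "e \<in> regular_identities ar E" for e
    using that unfolding regular_identities_def
    by (auto intro: variety_satisfies_any_type[OF assms(1) _ _ assms(2)])
  then show ?thesis using assms(2) unfolding in_variety_def by blast
qed

text \<open>A semilattice of sets satisfies all regular identities and detects the variables of a
  term. Conversely, after renaming, an entailed pair with equal variables is literally one of the
  regular identities.\<close>

lemma entails_regular_iff:
  fixes s s' :: "('f, 'v) trm"
  assumes E: "\<forall>e\<in>E. is_identity ar e" and wf: "wf_trm ar s" "wf_trm ar s'"
  shows "entails ar (regular_identities ar E) s s' \<longleftrightarrow> vars s = vars s' \<and> entails ar E s s'"
proof
  assume ent: "entails ar (regular_identities ar E) s s'"
  have "entails ar E s s'"
    using ent in_variety_regular[OF E] unfolding entails_def by blast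
  moreover have "vars s = vars s'"
  proof -
    \<comment> \<open>Every operation is the union of its arguments, and constants are empty.
      Assigning \<open>{x}\<close> to each variable \<open>x\<close> makes the value of a term its
      set of variables.\<close>
    define L :: "('f, 'v set) algebra" where "L = \<lparr>carrier = UNIV, opr = \<lambda>f as. \<Union>(set as)\<rparr>"
    have ev: "eval L \<rho> u = (\<Union>x\<in>vars u. \<rho> x)" for \<rho> :: "'w \<Rightarrow> 'v set" and u
      by (induction u) (auto simp: L_def)
    have "in_variety ar (regular_identities ar E) L"
      unfolding in_variety_def is_algebra_def satisfies_def ev
      by (auto simp: L_def regular_identities_def)
    then have "eval L (\<lambda>x. {x}) s = eval L (\<lambda>x. {x}) s'"
      by (intro entails_eval[OF regular_identities_identity ent wf]) (auto simp: L_def)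
    then show ?thesis unfolding ev by auto
  qed
  ultimately show "vars s = vars s' \<and> entails ar E s s'" by blast
next
  assume asm: "vars s = vars s' \<and> entails ar E s s'"
  obtain r :: "'v \<Rightarrow> nat" and r' where r: "\<forall>x\<in>vars s \<union> vars s'. r' (r x) = x"
    using rename_to_nat[of s s'] by blast
  define e where "e = (subst (Var \<circ> r) s, subst (Var \<circ> r) s')"
  have "entails ar E (fst e) (snd e)"
    unfolding e_def fst_conv snd_conv using asm by (intro entails_subst) auto
  then have e: "e \<in> regular_identities ar E"
    unfolding regular_identities_def is_identity_def using wf asm
    by (auto simp: e_def entails_identity vars_subst intro!: wf_subst)
  show "entails ar (regular_identities ar E) s s'"
  proof (rule entailsI)
    fix B :: "('f, ('f, nat) trm) algebra" and \<rho> :: "'v \<Rightarrow> ('f, nat) trm"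
    assume B: "in_variety ar (regular_identities ar E) B" "range \<rho> \<subseteq> carrier B"
    \<comment> \<open>The assignment \<open>\<rho> \<circ> r'\<close> undoes the renaming on the
      variables that occur.\<close>
    then have "range (\<rho> \<circ> r') \<subseteq> carrier B" by auto
    then have "eval B (\<rho> \<circ> r') (fst e) = eval B (\<rho> \<circ> r') (snd e)"
      using e B(1) unfolding in_variety_def satisfies_def by blast
    then have "eval B (\<lambda>x. \<rho> (r' (r x))) s = eval B (\<lambda>x. \<rho> (r' (r x))) s'"
      by (simp add: e_def eval_subst)
    moreover have "eval B (\<lambda>x. \<rho> (r' (r x))) u = eval B \<rho> u" if "u \<in> {s, s'}" for u
      using that r by (intro eval_cong) auto
    ultimately show "eval B \<rho> s = eval B \<rho> s'" by simp
  qed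
qed

section \<open>The free semilattice with zero\<close>

text \<open>Joins and bottom are computed through the isomorphism \<open>\<theta>\<close>. It serves
  both for the index semilattice of a given system and, with \<open>\<theta>\<close> the identity,
  for the finite subsets themselves.\<close>

locale finite_subset_semilattice = partial_order L for L :: "'i gorder" (structure) +
  fixes J :: "'j set" and \<theta> :: "'i \<Rightarrow> 'j set"
  assumes bij: "bij_betw \<theta> (carrier L) (Fpow J)"
    and le_iff: "x \<in> carrier L \<Longrightarrow> y \<in> carrier L \<Longrightarrow> x \<sqsubseteq> y \<longleftrightarrow> \<theta> x \<subseteq> \<theta> y"
begin

lemma theta_Fpow: "x \<in> carrier L \<Longrightarrow> finite (\<theta> x) \<and> \<theta> x \<subseteq> J"
  using bij_betw_apply[OF bij] unfolding Fpow_def by blast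

lemma theta_eqD: "x \<in> carrier L \<Longrightarrow> y \<in> carrier L \<Longrightarrow> \<theta> x = \<theta> y \<Longrightarrow> x = y"
  using bij unfolding bij_betw_def by (auto dest: inj_onD)

lemma theta_surj: "finite F \<Longrightarrow> F \<subseteq> J \<Longrightarrow> \<exists>x\<in>carrier L. \<theta> x = F"
  using bij_betw_imp_surj_on[OF bij] unfolding Fpow_def by (metis (mono_tags, lifting) imageE mem_Collect_eq)

lemma least_Upper:
  assumes "F \<subseteq> carrier L" "x \<in> carrier L" "\<theta> x = (\<Union>y\<in>F. \<theta> y)"
  shows "least L x (Upper L F)"
proof -
  have above: "x \<sqsubseteq> z \<longleftrightarrow> (\<forall>y\<in>F. y \<sqsubseteq> z)" if "z \<in> carrier L" for z
    using le_iff[OF _ that] assms by (simp add: subset_iff) blast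
  have "\<forall>y\<in>F. y \<sqsubseteq> x" using above[OF assms(2)] le_refl[OF assms(2)] by blast
  then show ?thesis
    unfolding least_def Upper_def using assms(1,2) above by auto
qed

text \<open>The join is a choice among least upper bounds; in a partial order there is at most one,
  and the preimage of the union is one. The case \<open>F = {}\<close> makes the join of no
  generators the least index.\<close>

lemma sup_theta:
  assumes "F \<subseteq> carrier L" "finite F"
  shows "\<Squnion>F \<in> carrier L" "\<theta> (\<Squnion>F) = (\<Union>y\<in>F. \<theta> y)"
proof -
  obtain x where x: "x \<in> carrier L" "\<theta> x = (\<Union>y\<in>F. \<theta> y)"
    using theta_surj[of "\<Union>y\<in>F. \<theta> y"] theta_Fpow assms by blast
  have "\<Squnion>F = x"
    unfolding sup_def using least_Upper[OF assms(1) x] by (intro some_equality) (auto intro: least_unique)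
  then show "\<Squnion>F \<in> carrier L" "\<theta> (\<Squnion>F) = (\<Union>y\<in>F. \<theta> y)" using x by auto
qed

lemma ex_bottom: "\<exists>x\<in>carrier L. \<theta> x = {} \<and> least L x (carrier L)"
proof -
  obtain x where x: "x \<in> carrier L" "\<theta> x = {}" using theta_surj[of "{}"] by blast
  then have "least L x (carrier L)" by (simp add: least_def le_iff)
  with x show ?thesis by blast
qed

lemma bottom_theta: "\<bottom> \<in> carrier L" "\<theta> \<bottom> = {}"
proof -
  obtain x where x: "x \<in> carrier L" "\<theta> x = {}" "least L x (carrier L)" using ex_bottom by blast
  then have "\<bottom> = x"
    unfolding bottom_def by (intro some_equality) (auto intro: least_unique)
  then show "\<bottom> \<in> carrier L" "\<theta> \<bottom> = {}" using x by auto
qed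

lemma semilattice_with_zero: "semilattice_with_zero L"
  unfolding semilattice_with_zero_def
proof
  show "upper_semilattice L"
  proof unfold_locales
    fix x y assume xy: "x \<in> carrier L" "y \<in> carrier L"
    obtain z where "z \<in> carrier L" "\<theta> z = \<theta> x \<union> \<theta> y"
      using theta_surj[of "\<theta> x \<union> \<theta> y"] theta_Fpow xy by blast
    then show "\<exists>s. least L s (Upper L {x, y})"
      using xy least_Upper[of "{x, y}" z] by auto
  qed
  show "weak_partial_order_bottom L"
    by unfold_locales (use ex_bottom in blast)
qed

end

section \<open>From a free algebra to a direct system\<close>

locale strongly_irregular_variety =
  fixes ar :: "'f \<Rightarrow> nat" and E :: "'f identity set" and t :: "('f, nat) trm"
  assumes E: "\<forall>e\<in>E. is_identity ar e"
    and wf_t: "wf_trm ar t" and vars_t: "vars t = {0, 1}"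
    and t_left: "variety_satisfies ar E (t, Var 0)"
begin

text \<open>This is \<open>t(s, u)\<close>, which modulo the variety equals \<open>s\<close>. Only
  \<open>0\<close> and \<open>1\<close> occur in \<open>t\<close>, so all nonzero variables may be
  sent to \<open>u\<close>.\<close>

definition absorb :: "('f, 'v) trm \<Rightarrow> ('f, 'v) trm \<Rightarrow> ('f, 'v) trm" where
  "absorb s u = subst (\<lambda>n. if n = 0 then s else u) t"

text \<open>A list is used because \<open>t\<close> need not be symmetric or associative. Modulo
  regular identities only the set of listed variables matters, so any enumeration of it will
  do.\<close>

definition pad :: "('f, 'v) trm \<Rightarrow> 'v list \<Rightarrow> ('f, 'v) trm" where
  "pad s js = foldl (\<lambda>s j. absorb s (Var j)) s js"

lemma wf_absorb: "wf_trm ar s \<Longrightarrow> wf_trm ar u \<Longrightarrow> wf_trm ar (absorb s u)"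
  unfolding absorb_def by (simp add: wf_subst wf_t)

lemma vars_absorb: "vars (absorb s u) = vars s \<union> vars u"
  unfolding absorb_def by (simp add: vars_subst vars_t)

lemma eval_absorb:
  "eval B \<rho> (absorb s u) = eval B (\<lambda>n. if n = 0 then eval B \<rho> s else eval B \<rho> u) t"
  unfolding absorb_def eval_subst by (rule eval_cong) simp

lemma wf_pad: "wf_trm ar s \<Longrightarrow> wf_trm ar (pad s js)"
  unfolding pad_def by (induction js arbitrary: s) (simp_all add: wf_absorb)

lemma vars_pad: "vars (pad s js) = vars s \<union> set js"
  unfolding pad_def by (induction js arbitrary: s) (auto simp: vars_absorb)

lemma eval_pad:
  fixes B :: "('f, ('f, nat) trm) algebra"
  assumes B: "in_variety ar E B" and \<rho>: "range \<rho> \<subseteq> carrier B" and s: "wf_trm ar s"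
  shows "eval B \<rho> (pad s js) = eval B \<rho> s"
  unfolding pad_def using s
proof (induction js arbitrary: s)
  case (Cons j js)
  have "eval B \<rho> s \<in> carrier B"
    using B Cons.prems \<rho> unfolding in_variety_def by (auto intro!: eval_closed)
  then have "range (\<lambda>n :: nat. if n = 0 then eval B \<rho> s else \<rho> j) \<subseteq> carrier B"
    using \<rho> by auto
  then have "eval B \<rho> (absorb s (Var j)) = eval B \<rho> s"
    using B t_left unfolding variety_satisfies_def satisfies_def eval_absorb by fastforce
  then show ?case
    using Cons by (simp add: wf_absorb)
qed simp

end

section \<open>The components and their freeness\<close>

locale free_regular_algebra = strongly_irregular_variety ar E t
  for ar :: "'f \<Rightarrow> nat" and E :: "'f identity set" and t +
  fixes A :: "('f, 'a) algebra" and J :: "'j set" and a :: "'j \<Rightarrow> 'a"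
  assumes free: "free_on ar (regular_identities ar E) A J a"
begin

definition enum :: "'j set \<Rightarrow> 'j list" where
  "enum k = (SOME js. set js = k)"

definition tms :: "'j set \<Rightarrow> ('f, 'j) trm set" where
  "tms k = {s. wf_trm ar s \<and> vars s = k}"

text \<open>Padding carried out on elements of \<open>A\<close> instead of terms, so that no
  representing term has to be chosen; \<open>fill_eval\<close> relates the two.\<close>

definition fill :: "'j set \<Rightarrow> 'a \<Rightarrow> 'a" where
  "fill k x = foldl (\<lambda>x j. eval A (\<lambda>n. if n = 0 then x else a j) t) x (enum k)"

text \<open>An operation of positive arity already maps values of terms with variable set
  \<open>k\<close> to such values, and \<open>fill k\<close> fixes these. The filling matters for
  constants, which have no variables and must be moved into the component.\<close>

definition component :: "'j set \<Rightarrow> ('f, 'a) algebra" where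
  "component k = \<lparr>carrier = eval A a ` tms k, opr = \<lambda>f as. fill k (opr A f as)\<rparr>"

text \<open>The element \<open>a j\<close> lies in the component of \<open>{j}\<close>; multiplying
  by the variables of \<open>k\<close> moves it to the component of \<open>k\<close>.\<close>

definition gens :: "'j set \<Rightarrow> 'j \<Rightarrow> 'a" where
  "gens k j = fill k (a j)"

abbreviation padk :: "'j set \<Rightarrow> ('f, 'j) trm \<Rightarrow> ('f, 'j) trm" where
  "padk k s \<equiv> pad s (enum k)"

lemma set_enum: "k \<in> Fpow J \<Longrightarrow> set (enum k) = k"
  unfolding enum_def by (rule someI_ex) (auto simp: Fpow_def intro: finite_list)

lemma fill_eval: "fill k (eval A a s) = eval A a (padk k s)"
proof -
  have "foldl (\<lambda>x j. eval A (\<lambda>n. if n = 0 then x else a j) t) (eval A a s) js = eval A a (pad s js)"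
    for js
    unfolding pad_def
  proof (induction js arbitrary: s)
    case (Cons j js)
    show ?case using Cons[of "absorb s (Var j)"] by (simp add: eval_absorb cong: if_cong)
  qed simp
  then show ?thesis unfolding fill_def by simp
qed

lemma tms_padk: "k \<in> Fpow J \<Longrightarrow> wf_trm ar s \<Longrightarrow> vars s \<subseteq> k \<Longrightarrow> padk k s \<in> tms k"
  unfolding tms_def by (auto simp: wf_pad vars_pad set_enum)

text \<open>This combines freeness of \<open>A\<close> with the description of regular entailment.
  It makes distinct components disjoint and reduces equality inside a component to equality modulo
  \<open>E\<close>.\<close>

lemma eval_eq_iff:
  assumes "i \<in> Fpow J" "k \<in> Fpow J" "s \<in> tms i" "s' \<in> tms k"
  shows "eval A a s = eval A a s' \<longleftrightarrow> i = k \<and> entails ar E s s'"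
proof -
  have s: "wf_trm ar s" "vars s = i" "vars s \<subseteq> J" "wf_trm ar s'" "vars s' = k" "vars s' \<subseteq> J"
    using assms unfolding tms_def Fpow_def by auto
  have "eval A a s = eval A a s' \<longleftrightarrow> entails ar (regular_identities ar E) s s'"
    using s by (intro free_on_eval_iff[OF regular_identities_identity free])
  then show ?thesis using s entails_regular_iff[OF E, of s s'] by simp
qed

text \<open>The working form of the criterion: once both terms have variable set \<open>k\<close>,
  they may be compared in members of the variety, where \<open>eval_pad\<close> erases all
  padding.\<close>

lemma eval_eqI:
  assumes "k \<in> Fpow J" "s \<in> tms k" "s' \<in> tms k"
    and "\<And>(B :: ('f, ('f, nat) trm) algebra) \<rho>.
      in_variety ar E B \<Longrightarrow> range \<rho> \<subseteq> carrier B \<Longrightarrow> eval B \<rho> s = eval B \<rho> s'"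
  shows "eval A a s = eval A a s'"
  using assms eval_eq_iff[OF assms(1) assms(1)] by (auto intro: entailsI)

lemma map_eval_terms:
  assumes "set as \<subseteq> eval A a ` T"
  obtains ss where "as = map (eval A a) ss" "set ss \<subseteq> T"
proof
  show "as = map (eval A a) (map (inv_into T (eval A a)) as)"
    using assms by (auto intro!: map_idI[symmetric] simp: f_inv_into_f subset_iff)
  show "set (map (inv_into T (eval A a)) as) \<subseteq> T"
    using assms by (auto intro: inv_into_into)
qed

lemma carrier_component: "carrier (component k) = eval A a ` tms k"
  by (simp add: component_def)

lemma opr_component: "opr (component k) f (map (eval A a) ss) = eval A a (padk k (Op f ss))"
  by (simp add: component_def flip: fill_eval)

lemma gens_eval: "gens k j = eval A a (padk k (Var j))"
  by (simp add: gens_def flip: fill_eval)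

lemma wf_Op: "length ss = ar f \<Longrightarrow> set ss \<subseteq> tms k \<Longrightarrow> wf_trm ar (Op f ss) \<and> vars (Op f ss) \<subseteq> k"
  unfolding tms_def by (auto simp: list_all_iff)

text \<open>The outer padding gives both terms the variable set \<open>k\<close>, so the inner
  padding is invisible. This is what makes \<open>fill k\<close> compatible with operations.\<close>

lemma eval_padk_Op:
  assumes k: "k \<in> Fpow J" and ss: "length ss = ar f" "\<And>s. s \<in> set ss \<Longrightarrow> wf_trm ar s \<and> vars s \<subseteq> k"
  shows "eval A a (padk k (Op f (map (padk k) ss))) = eval A a (padk k (Op f ss))"
proof (rule eval_eqI[OF k])
  have wf: "wf_trm ar (Op f ss)" "wf_trm ar (Op f (map (padk k) ss))"
    using ss by (auto simp: list_all_iff wf_pad)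
  have vars_padk: "vars (padk k s) \<subseteq> k" if "s \<in> set ss" for s
    using ss(2)[OF that] by (simp add: vars_pad set_enum k)
  have vars: "vars (Op f ss) \<subseteq> k" "vars (Op f (map (padk k) ss)) \<subseteq> k"
    using ss(2) vars_padk by fastforce+
  show "padk k (Op f ss) \<in> tms k" "padk k (Op f (map (padk k) ss)) \<in> tms k"
    using wf vars by (auto intro!: tms_padk k simp del: wf_trm.simps trm.set)
  fix B :: "('f, ('f, nat) trm) algebra" and \<rho> :: "'j \<Rightarrow> ('f, nat) trm"
  assume B: "in_variety ar E B" "range \<rho> \<subseteq> carrier B"
  have "map (eval B \<rho>) (map (padk k) ss) = map (eval B \<rho>) ss"
    using ss by (simp add: eval_pad[OF B])
  then have "eval B \<rho> (Op f (map (padk k) ss)) = eval B \<rho> (Op f ss)"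
    by (simp only: eval.simps)
  then show "eval B \<rho> (padk k (Op f (map (padk k) ss))) = eval B \<rho> (padk k (Op f ss))"
    using wf by (simp only: eval_pad[OF B])
qed

lemma eval_tms_padk: "k \<in> Fpow J \<Longrightarrow> s \<in> tms k \<Longrightarrow> eval A a (padk k s) = eval A a s"
  by (rule eval_eqI) (auto simp: eval_pad tms_def wf_pad vars_pad set_enum)

lemma is_algebra_component:
  assumes k: "k \<in> Fpow J"
  shows "is_algebra ar (component k)"
  unfolding is_algebra_def
proof (intro allI impI)
  fix f as assume as: "length as = ar f \<and> set as \<subseteq> carrier (component k)"
  then have "set as \<subseteq> eval A a ` tms k" by (simp add: carrier_component)
  then obtain ss where ss: "as = map (eval A a) ss" "set ss \<subseteq> tms k" by (rule map_eval_terms)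
  then have "padk k (Op f ss) \<in> tms k" using wf_Op[of ss f k] as by (intro tms_padk k) auto
  then show "opr (component k) f as \<in> carrier (component k)"
    unfolding ss(1) opr_component carrier_component by blast
qed

text \<open>Evaluation in the component pads after every operation symbol; by
  \<open>eval_padk_Op\<close> all these paddings collapse into a single outer one.\<close>

lemma eval_component:
  assumes k: "k \<in> Fpow J" and s: "wf_trm ar s" and \<sigma>: "\<And>x. x \<in> vars s \<Longrightarrow> \<sigma> x \<in> tms k"
  shows "eval (component k) (\<lambda>x. eval A a (\<sigma> x)) s = eval A a (padk k (subst \<sigma> s))"
  using s \<sigma>
proof (induction s)
  case (Var x)
  then have "\<sigma> x \<in> tms k" "wf_trm ar (\<sigma> x)" "vars (\<sigma> x) \<subseteq> k" by (auto simp: tms_def)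
  then show ?case by (auto intro!: eval_eqI[OF k] tms_padk k simp: eval_pad)
next
  case (Op f ts)
  have wf: "wf_trm ar (subst \<sigma> s)" "vars (subst \<sigma> s) \<subseteq> k" if "s \<in> set ts" for s
    using that Op.prems by (auto simp: list_all_iff tms_def vars_subst intro!: wf_subst)
  have IH: "eval (component k) (\<lambda>x. eval A a (\<sigma> x)) s = eval A a (padk k (subst \<sigma> s))"
    if "s \<in> set ts" for s
    using that Op.prems by (intro Op.IH) (auto simp: list_all_iff)
  have "eval (component k) (\<lambda>x. eval A a (\<sigma> x)) (Op f ts) =
      opr (component k) f (map (eval A a) (map (padk k) (map (subst \<sigma>) ts)))"
    using IH by (simp add: comp_def cong: map_cong)
  also have "\<dots> = eval A a (padk k (Op f (map (padk k) (map (subst \<sigma>) ts))))"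
    by (rule opr_component)
  also have "\<dots> = eval A a (padk k (Op f (map (subst \<sigma>) ts)))"
    using wf Op.prems by (intro eval_padk_Op k) auto
  finally show ?case by simp
qed

text \<open>Even if an identity of \<open>E\<close> is irregular, substituting terms with variable
  set \<open>k\<close> and padding by \<open>k\<close> gives two sides with the same variables. The
  resulting pair is regular and therefore holds in \<open>A\<close>.\<close>

lemma in_variety_component:
  assumes k: "k \<in> Fpow J"
  shows "in_variety ar E (component k)"
  unfolding in_variety_def
proof (intro conjI ballI is_algebra_component k)
  fix e assume e: "e \<in> E"
  then have wf: "wf_trm ar (fst e)" "wf_trm ar (snd e)" using E unfolding is_identity_def by auto
  show "satisfies (component k) e"
    unfolding satisfies_def
  proof (intro allI impI)
    fix \<rho> :: "nat \<Rightarrow> 'a" assume "range \<rho> \<subseteq> carrier (component k)"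
    then have "\<forall>n. \<exists>s. s \<in> tms k \<and> \<rho> n = eval A a s" unfolding carrier_component by blast
    then obtain \<sigma> where \<sigma>: "\<And>n. \<sigma> n \<in> tms k" "\<And>n. \<rho> n = eval A a (\<sigma> n)" by metis
    then have \<sigma>': "wf_trm ar (\<sigma> n)" "vars (\<sigma> n) = k" for n by (auto simp: tms_def)
    have \<rho>: "\<rho> = (\<lambda>n. eval A a (\<sigma> n))" using \<sigma>(2) by auto
    have tm: "padk k (subst \<sigma> u) \<in> tms k" if "wf_trm ar u" for u
      using that \<sigma>' by (intro tms_padk k) (auto simp: vars_subst intro!: wf_subst)
    have "eval A a (padk k (subst \<sigma> (fst e))) = eval A a (padk k (subst \<sigma> (snd e)))"
    proof (rule eval_eqI[OF k tm tm])
      fix B :: "('f, ('f, nat) trm) algebra" and \<rho> :: "'j \<Rightarrow> ('f, nat) trm"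
      assume B: "in_variety ar E B" "range \<rho> \<subseteq> carrier B"
      then have "range (\<lambda>n. eval B \<rho> (\<sigma> n)) \<subseteq> carrier B"
        using \<sigma>' unfolding in_variety_def by (auto intro!: eval_closed)
      then have "eval B \<rho> (subst \<sigma> (fst e)) = eval B \<rho> (subst \<sigma> (snd e))"
        using B e unfolding in_variety_def satisfies_def eval_subst by blast
      then show "eval B \<rho> (padk k (subst \<sigma> (fst e))) = eval B \<rho> (padk k (subst \<sigma> (snd e)))"
        using B wf \<sigma>' by (simp add: eval_pad wf_subst)
    qed (use wf in auto)
    then show "eval (component k) \<rho> (fst e) = eval (component k) \<rho> (snd e)"
      unfolding \<rho> by (simp add: eval_component[OF k] wf \<sigma>)
  qed
qed

lemma eval_gens:
  assumes k: "k \<in> Fpow J" and s: "wf_trm ar s" "vars s \<subseteq> k"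
  shows "eval (component k) (gens k) s = eval A a (padk k s)"
proof -
  have wf: "wf_trm ar (subst (\<lambda>j. padk k (Var j)) s)" using s by (auto intro!: wf_subst wf_pad)
  have "eval (component k) (gens k) s = eval A a (padk k (subst (\<lambda>j. padk k (Var j)) s))"
    unfolding gens_eval[abs_def] using s by (intro eval_component k tms_padk) auto
  also have "\<dots> = eval A a (padk k s)"
    using s wf
    by (intro eval_eqI[OF k] tms_padk k)
      (auto simp: eval_pad eval_subst vars_subst vars_pad set_enum k)
  finally show ?thesis .
qed

lemma entails_padk_iff:
  "wf_trm ar s \<Longrightarrow> wf_trm ar s' \<Longrightarrow> entails ar E (padk k s) (padk k' s') \<longleftrightarrow> entails ar E s s'"
  unfolding entails_def by (auto simp: eval_pad)

lemma gens_in_component: "k \<in> Fpow J \<Longrightarrow> j \<in> k \<Longrightarrow> gens k j \<in> carrier (component k)"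
  unfolding gens_eval carrier_component by (intro imageI tms_padk) auto

text \<open>Padding by \<open>k\<close> fixes the values of terms in \<open>tms k\<close>, so every
  element is a value at \<open>gens k\<close>. Since padding changes nothing modulo
  \<open>E\<close>, two terms with equal values at \<open>gens k\<close> are equal modulo
  \<open>E\<close>.\<close>

lemma free_on_component:
  assumes k: "k \<in> Fpow J"
  shows "free_on ar E (component k) k (gens k)"
proof (rule free_onI[OF E in_variety_component[OF k]])
  show "gens k j \<in> carrier (component k)" if "j \<in> k" for j
    using gens_in_component[OF k that] .
  show "carrier (component k) \<subseteq> subuniverse_gen ar (component k) (gens k ` k)"
  proof
    fix x assume "x \<in> carrier (component k)"
    then obtain s where s: "s \<in> tms k" "x = eval A a s" unfolding carrier_component by blast
    then have "x = eval (component k) (gens k) s" "wf_trm ar s" "vars s \<subseteq> k"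
      using eval_gens[OF k, of s] eval_tms_padk[OF k] by (auto simp: tms_def)
    then show "x \<in> subuniverse_gen ar (component k) (gens k ` k)"
      unfolding subuniverse_gen_eval by blast
  qed
  fix s s' assume s: "wf_trm ar s" "vars s \<subseteq> k" "wf_trm ar s'" "vars s' \<subseteq> k"
    and "eval (component k) (gens k) s = eval (component k) (gens k) s'"
  then have "eval A a (padk k s) = eval A a (padk k s')" by (simp add: eval_gens[OF k])
  then have "entails ar E (padk k s) (padk k s')"
    using eval_eq_iff[OF k k tms_padk[OF k] tms_padk[OF k]] s by blast
  then show "entails ar E s s'" using s by (simp add: entails_padk_iff)
qed

section \<open>Transition maps\<close>

lemma hom_fill:
  assumes i: "i \<in> Fpow J" and k: "k \<in> Fpow J" and ik: "i \<subseteq> k"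
  shows "is_hom ar (component i) (component k) (fill k)"
  unfolding is_hom_def
proof (intro conjI ballI allI impI)
  fix x assume "x \<in> carrier (component i)"
  then obtain s where s: "s \<in> tms i" "x = eval A a s" unfolding carrier_component by blast
  then show "fill k x \<in> carrier (component k)"
    using ik unfolding carrier_component s(2) fill_eval by (intro imageI tms_padk k) (auto simp: tms_def)
next
  fix f as assume as: "length as = ar f \<and> set as \<subseteq> carrier (component i)"
  then have "set as \<subseteq> eval A a ` tms i" by (simp add: carrier_component)
  then obtain ss where ss: "as = map (eval A a) ss" "set ss \<subseteq> tms i" by (rule map_eval_terms)
  have wf: "wf_trm ar s" "vars s \<subseteq> k" if "s \<in> set ss" for s
    using ss(2) that ik by (auto simp: tms_def)
  have "padk i (Op f ss) \<in> tms i"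
    using wf_Op[of ss f i] as ss by (intro tms_padk i) auto
  then have wfO: "wf_trm ar (Op f ss)" "wf_trm ar (padk i (Op f ss))" "vars (padk i (Op f ss)) \<subseteq> k"
    using wf_Op[of ss f i] as ss ik by (auto simp: tms_def)
  \<comment> \<open>Padding by \<open>i\<close> is absorbed by the later padding by
    \<open>k\<close>, which is then distributed to the arguments.\<close>
  have "fill k (opr (component i) f as) = eval A a (padk k (padk i (Op f ss)))"
    by (simp only: ss(1) opr_component fill_eval)
  also have "\<dots> = eval A a (padk k (Op f ss))"
    using wfO wf by (intro eval_eqI[OF k] tms_padk k) (auto simp: eval_pad)
  also have "\<dots> = eval A a (padk k (Op f (map (padk k) ss)))"
    using wf as ss(1) by (intro eval_padk_Op[symmetric] k) auto
  also have "\<dots> = opr (component k) f (map (eval A a) (map (padk k) ss))"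
    by (rule opr_component[symmetric])
  also have "map (eval A a) (map (padk k) ss) = map (fill k) as"
    unfolding ss(1) by (simp add: fill_eval)
  finally show "fill k (opr (component i) f as) = opr (component k) f (map (fill k) as)" .
qed

lemma fill_id:
  "k \<in> Fpow J \<Longrightarrow> x \<in> carrier (component k) \<Longrightarrow> fill k x = x"
  unfolding carrier_component by (auto simp: fill_eval eval_tms_padk)

lemma fill_fill:
  assumes k: "k \<in> Fpow J" and j: "j \<in> Fpow J" and "i \<subseteq> j" "j \<subseteq> k" and x: "x \<in> carrier (component i)"
  shows "fill k (fill j x) = fill k x"
proof -
  obtain s where s: "s \<in> tms i" "x = eval A a s" using x unfolding carrier_component by blast
  show ?thesis
    unfolding s(2) fill_eval using s(1) assms(3,4)
    by (intro eval_eqI[OF k] tms_padk k)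
      (auto simp: tms_def wf_pad vars_pad set_enum j eval_pad)
qed

text \<open>Within a component an element determines its term modulo \<open>E\<close>, and padding
  preserves the term modulo \<open>E\<close>; hence nothing is identified.\<close>

lemma inj_fill:
  assumes i: "i \<in> Fpow J" and k: "k \<in> Fpow J" and ik: "i \<subseteq> k"
  shows "inj_on (fill k) (carrier (component i))"
proof (rule inj_onI)
  fix x y assume "x \<in> carrier (component i)" "y \<in> carrier (component i)" and eq: "fill k x = fill k y"
  then obtain s s' where s: "s \<in> tms i" "x = eval A a s" "s' \<in> tms i" "y = eval A a s'"
    unfolding carrier_component by blast
  have wf: "wf_trm ar s" "vars s \<subseteq> k" "wf_trm ar s'" "vars s' \<subseteq> k"
    using s ik by (auto simp: tms_def)
  have "entails ar E (padk k s) (padk k s')"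
    using eq eval_eq_iff[OF k k tms_padk[OF k wf(1,2)] tms_padk[OF k wf(3,4)]] s
    by (simp add: fill_eval)
  then have "entails ar E s s'" using wf by (simp add: entails_padk_iff)
  then show "x = y" using s eval_eq_iff[OF i i s(1,3)] by simp
qed

lemma fill_gens: "i \<in> Fpow J \<Longrightarrow> k \<in> Fpow J \<Longrightarrow> i \<subseteq> k \<Longrightarrow> j \<in> i \<Longrightarrow> fill k (gens i j) = gens k j"
  unfolding gens_eval fill_eval
  by (intro eval_eqI[of k] tms_padk) (auto simp: wf_pad vars_pad set_enum eval_pad)

lemma hom_component_unique:
  assumes k: "k \<in> Fpow J" and "is_hom ar (component k) B p" "is_hom ar (component k) B q"
    and "\<forall>j\<in>k. p (gens k j) = q (gens k j)" and x: "x \<in> carrier (component k)"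
  shows "p x = q x"
proof -
  have "x \<in> subuniverse_gen ar (component k) (gens k ` k)"
    using free_on_component[OF k] x unfolding free_on_def by blast
  then show ?thesis
    using hom_eq_on_gen[OF is_algebra_component[OF k] assms(2,3), of "gens k ` k"] assms(4)
      gens_in_component[OF k] by blast
qed

lemma fill_unique_inj_hom:
  assumes i: "i \<in> Fpow J" and k: "k \<in> Fpow J" and ik: "i \<subseteq> k"
  shows "is_unique_inj_hom_extending ar (component i) (component k) i (gens i) (gens k) (fill k)"
proof -
  have "q x = fill k x"
    if "is_hom ar (component i) (component k) q" "\<forall>j\<in>i. q (gens i j) = gens k j" "x \<in> carrier (component i)"
    for q x
    by (rule hom_component_unique[OF i that(1) hom_fill[OF i k ik] _ that(3)])
      (simp add: that fill_gens[OF i k ik])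
  then show ?thesis
    unfolding is_unique_inj_hom_extending_def
    using hom_fill[OF i k ik] inj_fill[OF i k ik] fill_gens[OF i k ik] by blast
qed

text \<open>The component of \<open>{}\<close> has no generators, so the agreement required by
  \<open>hom_component_unique\<close> is vacuous.\<close>

lemma fill_unique_hom:
  assumes k: "k \<in> Fpow J"
  shows "is_unique_hom ar (component {}) (component k) (fill k)"
  unfolding is_unique_hom_def
  using hom_component_unique[OF empty_in_Fpow] hom_fill[OF empty_in_Fpow k] by blast

lemma gens_singleton:
  assumes "j \<in> J"
  shows "gens {j} j = a j"
  using assms eval_tms_padk[of "{j}" "Var j"] by (simp add: gens_eval tms_def Fpow_def)

section \<open>The semilattice of finite subsets and the Plonka sum\<close>

definition subsets :: "'j set gorder" where
  "subsets = \<lparr>carrier = Fpow J, eq = (=), le = (\<subseteq>)\<rparr>"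

text \<open>The transition map depends on the target alone: multiplying by all variables of
  \<open>k\<close> leads into the component of \<open>k\<close> from every smaller index.\<close>

definition system :: "('j set, 'f, 'a) direct_system" where
  "system = \<lparr>idx = subsets, cmp = component, trans = (\<lambda>i. fill)\<rparr>"

lemma subsets_simps [simp]: "carrier subsets = Fpow J" "x \<sqsubseteq>\<^bsub>subsets\<^esub> y \<longleftrightarrow> x \<subseteq> y"
  unfolding subsets_def by auto

lemma system_simps [simp]: "idx system = subsets" "cmp system = component" "trans system i = fill"
  unfolding system_def by auto

sublocale subsets: finite_subset_semilattice subsets J "\<lambda>x. x"
  by unfold_locales (auto simp: subsets_def bij_betw_def)

lemma bottom_subsets: "\<bottom>\<^bsub>subsets\<^esub> = {}"
  by (rule subsets.bottom_theta)

lemma sup_subsets: "F \<subseteq> Fpow J \<Longrightarrow> finite F \<Longrightarrow> \<Squnion>\<^bsub>subsets\<^esub> F = \<Union>F"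
  using subsets.sup_theta(2)[of F] by simp

lemma sup_singletons: "set js \<subseteq> J \<Longrightarrow> \<Squnion>\<^bsub>subsets\<^esub> ((\<lambda>j. {j}) ` set js) = set js"
  by (subst sup_subsets) (auto simp: Fpow_def)

lemma free_semilattice_subsets: "free_semilattice_with_zero subsets J (\<lambda>j. {j})"
  unfolding free_semilattice_with_zero_def
  using subsets.semilattice_with_zero subsets.bij
  by (auto intro!: exI[of _ "\<lambda>x. x"] simp: Fpow_def)

lemma component_disjoint:
  "i \<in> Fpow J \<Longrightarrow> k \<in> Fpow J \<Longrightarrow> i \<noteq> k \<Longrightarrow> carrier (component i) \<inter> carrier (component k) = {}"
  unfolding carrier_component using eval_eq_iff[of i k] by blast

lemma semilattice_direct_system_system: "semilattice_direct_system ar system"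
  unfolding semilattice_direct_system_def
  using subsets.semilattice_with_zero is_algebra_component component_disjoint hom_fill fill_id fill_fill
  by (simp, metis)

lemma plonka_sum_system: "is_plonka_sum ar system A"
  unfolding is_plonka_sum_def
proof (intro conjI allI impI)
  have "carrier A = {eval A a s | s. wf_trm ar s \<and> vars s \<subseteq> J}"
    using free unfolding free_on_def subuniverse_gen_eval by blast
  also have "\<dots> = (\<Union>k\<in>Fpow J. carrier (component k))"
    unfolding carrier_component tms_def Fpow_def using finite_vars by auto
  finally show "carrier A = (\<Union>k\<in>carrier (idx system). carrier (cmp system k))" by simp
next
  fix f and "is" :: "'j set list" and as
  assume asm: "ar f \<ge> 1 \<and> length as = ar f \<and> set is \<subseteq> carrier (idx system) \<and>
        list_all2 (\<lambda>i a. a \<in> carrier (cmp system i)) is as"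
  define k where "k = \<Union>(set is)"
  have sup: "\<Squnion>\<^bsub>idx system\<^esub> (set is) = k" unfolding k_def using asm by (simp add: sup_subsets)
  have k: "k \<in> Fpow J" using subsets.sup_theta(1)[of "set is"] asm sup by simp
  have len: "length is = length as" using asm by (auto dest: list_all2_lengthD)
  have "\<forall>n<length as. \<exists>s. s \<in> tms (is ! n) \<and> as ! n = eval A a s"
    using asm by (auto simp: list_all2_conv_all_nth carrier_component)
  then obtain s where s: "\<And>n. n < length as \<Longrightarrow> s n \<in> tms (is ! n) \<and> as ! n = eval A a (s n)"
    by metis
  define ss where "ss = map s [0..<length as]"
  have as: "as = map (eval A a) ss"
    unfolding ss_def using s by (intro nth_equalityI) auto
  have wf: "wf_trm ar u" if "u \<in> set ss" for u
    using that s unfolding ss_def tms_def by auto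
  \<comment> \<open>The variables of the composite term form the union of the indices, that is,
    their join. So the result computed in \<open>A\<close> lies in the component of the
    join.\<close>
  have "vars (Op f ss) = (\<Union>n<length as. vars (s n))" unfolding ss_def by auto
  also have "\<dots> = (\<Union>n<length is. is ! n)" using s len unfolding tms_def by auto
  also have "\<dots> = k" unfolding k_def by (auto simp: set_conv_nth)
  finally have vars: "vars (Op f ss) = k" .
  have Op: "Op f ss \<in> tms k" using wf vars asm as by (auto simp: tms_def list_all_iff)
  \<comment> \<open>Padding by \<open>k\<close> does not move this value and may be pushed into the
    arguments, where it becomes the transition maps.\<close>
  have "opr A f as = eval A a (Op f ss)" by (simp add: as)
  also have "\<dots> = eval A a (padk k (Op f ss))" by (rule eval_tms_padk[OF k Op, symmetric])
  also have "\<dots> = eval A a (padk k (Op f (map (padk k) ss)))"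
    using wf vars asm as by (intro eval_padk_Op[symmetric] k) auto
  also have "\<dots> = opr (component k) f (map (eval A a) (map (padk k) ss))" by (rule opr_component[symmetric])
  also have "map (eval A a) (map (padk k) ss) = map (fill k) as"
    unfolding as by (simp add: fill_eval)
  also have "map (fill k) as = map2 (\<lambda>i. fill k) is as"
    using len by (intro nth_equalityI) auto
  finally show "let k = \<Squnion>\<^bsub>idx system\<^esub> (set is)
     in opr A f as = opr (cmp system k) f (map2 (\<lambda>i a. trans system i k a) is as)"
    unfolding sup by simp
next
  fix f assume f: "ar f = 0"
  have "opr (component {}) f (map (eval A a) []) = eval A a (padk {} (Op f []))" by (rule opr_component)
  also have "\<dots> = eval A a (Op f [])"
    using f by (intro eval_tms_padk empty_in_Fpow) (simp add: tms_def)
  finally show "opr A f [] = opr (cmp system \<bottom>\<^bsub>idx system\<^esub>) f []"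
    by (simp add: bottom_subsets)
qed

end

section \<open>From a direct system to a free algebra\<close>

text \<open>A term is evaluated in \<open>A\<close> as in the free component indexed by its
  variables. Equal values lie in one component, so the terms have the same variables, and freeness
  of that component makes them equal modulo \<open>E\<close>; together this is regular
  entailment.\<close>

lemma (in strongly_irregular_variety) plonka_sum_free:
  fixes A :: "('f, 'a) algebra" and S :: "('i, 'f, 'a) direct_system" and \<iota> :: "'j \<Rightarrow> 'i"
  assumes A: "in_variety ar (regular_identities ar E) A"
    and S: "semilattice_direct_system ar S" and sum: "is_plonka_sum ar S A"
    and L: "free_semilattice_with_zero (idx S) J \<iota>"
    and fin: "\<And>i. i \<in> carrier (idx S) \<Longrightarrow> finite (T i)"
    and free: "\<And>i. i \<in> carrier (idx S) \<Longrightarrow> free_on ar E (cmp S i) (T i) (g i)"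
    and card: "\<And>i. i \<in> carrier (idx S) \<Longrightarrow>
      \<exists>js. length js = card (T i) \<and> distinct js \<and> set js \<subseteq> J \<and> i = \<Squnion>\<^bsub>idx S\<^esub> (\<iota> ` set js)"
    and single: "\<And>j. j \<in> J \<Longrightarrow> T (\<iota> j) = {j} \<and> g (\<iota> j) j = a j"
    and sub: "\<And>js. js \<noteq> [] \<Longrightarrow> set js \<subseteq> J \<Longrightarrow> set js \<subseteq> T (\<Squnion>\<^bsub>idx S\<^esub> (\<iota> ` set js))"
    and ext: "\<And>i k j. i \<in> carrier (idx S) \<Longrightarrow> k \<in> carrier (idx S) \<Longrightarrow> i \<noteq> \<bottom>\<^bsub>idx S\<^esub> \<Longrightarrow>
      i \<sqsubseteq>\<^bsub>idx S\<^esub> k \<Longrightarrow> j \<in> T i \<Longrightarrow> trans S i k (g i j) = g k j"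
  shows "free_on ar (regular_identities ar E) A J a"
proof -
  obtain \<theta> where \<theta>: "bij_betw \<theta> (carrier (idx S)) (Fpow J)"
      "\<forall>x\<in>carrier (idx S). \<forall>y\<in>carrier (idx S). x \<sqsubseteq>\<^bsub>idx S\<^esub> y \<longleftrightarrow> \<theta> x \<subseteq> \<theta> y"
      and \<iota>: "\<And>j. j \<in> J \<Longrightarrow> \<iota> j \<in> carrier (idx S) \<and> \<theta> (\<iota> j) = {j}"
    using L unfolding free_semilattice_with_zero_def by (elim conjE exE, intro that) auto
  have "partial_order (idx S)"
    using L unfolding free_semilattice_with_zero_def semilattice_with_zero_def
    by (auto dest: upper_semilattice.axioms(1))
  then interpret finite_subset_semilattice "idx S" J \<theta>
    using \<theta> by (simp add: finite_subset_semilattice_def finite_subset_semilattice_axioms_def)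
  \<comment> \<open>A list \<open>js\<close> whose join is \<open>i\<close> satisfies
    \<open>set js = \<theta> i\<close>. If nonempty, it is contained in \<open>T i\<close> by
    \<open>sub\<close> and has the same size; if empty, the finite set \<open>T i\<close> has size
    \<open>0\<close>.\<close>
  have T: "T i = \<theta> i" if i: "i \<in> carrier (idx S)" for i
  proof -
    obtain js where js: "length js = card (T i)" "distinct js" "set js \<subseteq> J"
      "i = \<Squnion>\<^bsub>idx S\<^esub> (\<iota> ` set js)"
      using card[OF i] by blast
    have "\<theta> i = (\<Union>y\<in>\<iota> ` set js. \<theta> y)"
      unfolding js(4) using js(3) \<iota> by (intro sup_theta) auto
    also have "\<dots> = (\<Union>j\<in>set js. {j})"
      unfolding image_image using js(3) \<iota> by (intro SUP_cong) auto
    finally have "\<theta> i = set js" by simp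
    moreover have "set js = T i"
    proof (cases "js = []")
      case True
      then show ?thesis using fin[OF i] js(1) by simp
    next
      case False
      then have "set js \<subseteq> T i" using sub js(3,4) by simp
      then show ?thesis using fin[OF i] js(1,2) by (intro card_subset_eq) (auto simp: distinct_card)
    qed
    ultimately show ?thesis by simp
  qed
  have alg: "is_algebra ar (cmp S i)" if "i \<in> carrier (idx S)" for i
    using S that unfolding semilattice_direct_system_def by blast
  have g_closed: "g i j \<in> carrier (cmp S i)" if "i \<in> carrier (idx S)" "j \<in> T i" for i j
    using free[OF that(1)] that(2) unfolding free_on_def by blast
  have opr_sum: "opr A f as = opr (cmp S (\<Squnion>\<^bsub>idx S\<^esub> (set is))) f
      (map2 (\<lambda>j x. trans S j (\<Squnion>\<^bsub>idx S\<^esub> (set is)) x) is as)"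
    if "ar f \<ge> 1" "length as = ar f" "set is \<subseteq> carrier (idx S)"
      "list_all2 (\<lambda>i a. a \<in> carrier (cmp S i)) is as" for f "is" as
    using sum that unfolding is_plonka_sum_def Let_def by blast
  \<comment> \<open>The key induction: \<open>A\<close> evaluates a term at \<open>a\<close> inside
    the component indexed by its variables, with that component's own generators.\<close>
  have eval_sum: "eval A a s = eval (cmp S i) (g i) s"
    if "wf_trm ar s" "i \<in> carrier (idx S)" "\<theta> i = vars s" for s i
    using that
  proof (induction s arbitrary: i)
    case (Var j)
    then have "j \<in> J" using theta_Fpow[of i] by auto
    then have "i = \<iota> j" using Var \<iota> by (intro theta_eqD) auto
    then show ?case using single \<open>j \<in> J\<close> by simp
  next
    case (Op f ss)
    have vars_J: "vars s \<subseteq> vars (Op f ss)" if "s \<in> set ss" for s using that by auto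
    \<comment> \<open>Each argument has its own variable set and hence its own index, which lies
      below \<open>i\<close>; existence comes from surjectivity of \<open>\<theta>\<close>.\<close>
    define ix where "ix s = (SOME i. i \<in> carrier (idx S) \<and> \<theta> i = vars s)" for s :: "('f, 'j) trm"
    have ix: "ix s \<in> carrier (idx S)" "\<theta> (ix s) = vars s" if "s \<in> set ss" for s :: "('f, 'j) trm"
    proof -
      have "\<exists>i\<in>carrier (idx S). \<theta> i = vars s"
        using theta_Fpow[of i] Op.prems vars_J[OF that] by (intro theta_surj) (auto simp: finite_vars)
      then have "\<exists>i. i \<in> carrier (idx S) \<and> \<theta> i = vars s" by blast
      from someI_ex[OF this]
      show "ix s \<in> carrier (idx S)" "\<theta> (ix s) = vars s" unfolding ix_def by auto
    qed
    have wf: "wf_trm ar s" if "s \<in> set ss" for s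
      using that Op.prems(1) by (auto simp: list_all_iff)
    have len: "length ss = ar f" using Op.prems(1) by simp
    have IH: "eval A a s = eval (cmp S (ix s)) (g (ix s)) s" if "s \<in> set ss" for s
      using Op.IH[OF that wf[OF that] ix[OF that]] .
    show ?case
    proof (cases "ar f = 0")
      case True
      then have "ss = []" using len by simp
      moreover have "i = \<bottom>\<^bsub>idx S\<^esub>"
        using Op.prems \<open>ss = []\<close> by (intro theta_eqD) (auto simp: bottom_theta)
      ultimately show ?thesis using sum True unfolding is_plonka_sum_def by simp
    next
      case False
      have ix_carrier: "set (map ix ss) \<subseteq> carrier (idx S)" using ix(1) by auto
      \<comment> \<open>Under \<open>\<theta>\<close> the join of the argument indices is the union
        of their variable sets, which is the variable set of the whole term.\<close>
      note sup_theta[OF ix_carrier finite_set]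
      then have k: "\<Squnion>\<^bsub>idx S\<^esub> (set (map ix ss)) = i"
        using Op.prems ix by (intro theta_eqD) auto
      have mem: "list_all2 (\<lambda>i a. a \<in> carrier (cmp S i)) (map ix ss) (map (eval A a) ss)"
        using ix wf T
        by (auto simp: list_all2_conv_all_nth IH intro!: eval_closed[OF alg] g_closed)
      have trans: "trans S (ix s) i (eval A a s) = eval (cmp S i) (g i) s" if s: "s \<in> set ss" for s
      proof -
        have le: "ix s \<sqsubseteq>\<^bsub>idx S\<^esub> i" using le_iff ix[OF s] Op.prems s by auto
        then have "is_hom ar (cmp S (ix s)) (cmp S i) (trans S (ix s) i)"
          using S ix[OF s] Op.prems unfolding semilattice_direct_system_def by blast
        then have "trans S (ix s) i (eval A a s) = eval (cmp S i) (trans S (ix s) i \<circ> g (ix s)) s"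
          unfolding IH[OF s] using ix[OF s] T
          by (intro hom_eval[OF alg] wf s) (auto intro!: g_closed)
        also have "\<dots> = eval (cmp S i) (g i) s"
        proof (rule eval_cong)
          \<comment> \<open>An occurring variable keeps the index away from bottom, so
            \<open>ext\<close> applies and the transition map sends generator to generator.\<close>
          fix j assume j: "j \<in> vars s"
          then have "ix s \<noteq> \<bottom>\<^bsub>idx S\<^esub>" using ix[OF s] bottom_theta by auto
          then show "(trans S (ix s) i \<circ> g (ix s)) j = g i j"
            using ext[OF ix(1)[OF s] Op.prems(2) _ le, of j] T[OF ix(1)[OF s]] ix(2)[OF s] j by simp
        qed
        finally show ?thesis .
      qed
      have "map2 (\<lambda>j x. trans S j i x) (map ix ss) (map (eval A a) ss) =
          map (\<lambda>s. trans S (ix s) i (eval A a s)) ss"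
        by (intro nth_equalityI) auto
      also have "\<dots> = map (eval (cmp S i) (g i)) ss" using trans by simp
      finally have map2: "map2 (\<lambda>j x. trans S j i x) (map ix ss) (map (eval A a) ss) =
          map (eval (cmp S i) (g i)) ss" .
      have "opr A f (map (eval A a) ss) = opr (cmp S (\<Squnion>\<^bsub>idx S\<^esub> (set (map ix ss)))) f
          (map2 (\<lambda>j x. trans S j (\<Squnion>\<^bsub>idx S\<^esub> (set (map ix ss))) x) (map ix ss) (map (eval A a) ss))"
        using False len ix_carrier mem by (intro opr_sum) simp_all
      then show ?thesis unfolding k map2 by simp
    qed
  qed
  have eval_mem: "eval A a s \<in> carrier (cmp S i)"
    if "wf_trm ar s" "i \<in> carrier (idx S)" "\<theta> i = vars s" for s i
    unfolding eval_sum[OF that] using that T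
    by (intro eval_closed[OF alg]) (auto intro!: g_closed)
  have carrier_sum: "carrier A = (\<Union>i\<in>carrier (idx S). carrier (cmp S i))"
    using sum unfolding is_plonka_sum_def by blast
  show ?thesis
  proof (rule free_onI[OF regular_identities_identity A])
    show "a j \<in> carrier A" if "j \<in> J" for j
      using eval_mem[of "Var j" "\<iota> j"] \<iota>[OF that] carrier_sum by auto
    show "carrier A \<subseteq> subuniverse_gen ar A (a ` J)"
    proof
      fix x assume "x \<in> carrier A"
      then obtain i where i: "i \<in> carrier (idx S)" "x \<in> carrier (cmp S i)"
        using carrier_sum by blast
      then have "x \<in> subuniverse_gen ar (cmp S i) (g i ` T i)"
        using free[OF i(1)] unfolding free_on_def by blast
      then obtain s where s: "x = eval (cmp S i) (g i) s" "wf_trm ar s" "vars s \<subseteq> \<theta> i"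
        unfolding subuniverse_gen_eval T[OF i(1)] by blast
      \<comment> \<open>The term \<open>s\<close> may use only some of the generators of its
        component. Padding it to all of \<open>\<theta> i\<close> keeps its value there and makes
        \<open>eval_sum\<close> applicable at index \<open>i\<close>.\<close>
      obtain js where js: "set js = \<theta> i" using theta_Fpow[OF i(1)] finite_list by blast
      have pad: "wf_trm ar (pad s js)" "vars (pad s js) = \<theta> i"
        using s js by (auto simp: wf_pad vars_pad)
      have "entails ar E (pad s js) s" using s by (auto intro!: entailsI simp: eval_pad)
      then have "eval (cmp S i) (g i) (pad s js) = x"
        unfolding s(1) using s pad T[OF i(1)] by (subst free_on_eval_iff[OF E free[OF i(1)]]) auto
      then have "x = eval A a (pad s js)" using eval_sum[OF pad(1) i(1)] pad(2) by simp
      then show "x \<in> subuniverse_gen ar A (a ` J)"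
        unfolding subuniverse_gen_eval using pad theta_Fpow[OF i(1)] by blast
    qed
    fix s s' :: "('f, 'j) trm"
    assume s: "wf_trm ar s" "vars s \<subseteq> J" and s': "wf_trm ar s'" "vars s' \<subseteq> J"
      and eq: "eval A a s = eval A a s'"
    obtain i where i: "i \<in> carrier (idx S)" "\<theta> i = vars s"
      using theta_surj[OF finite_vars s(2)] by blast
    obtain i' where i': "i' \<in> carrier (idx S)" "\<theta> i' = vars s'"
      using theta_surj[OF finite_vars s'(2)] by blast
    \<comment> \<open>The common value lies in both components, and components with different
      indices are disjoint.\<close>
    have "i = i'"
      using S i(1) i'(1) eval_mem[OF s(1) i] eval_mem[OF s'(1) i'] eq
      unfolding semilattice_direct_system_def by (metis disjoint_iff)
    then have "eval (cmp S i) (g i) s = eval (cmp S i) (g i) s'"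
      using eq eval_sum[OF s(1) i] eval_sum[OF s'(1) i'] by simp
    then have "entails ar E s s'"
      using free_on_eval_iff[OF E free[OF i(1)], of s s'] s s' i i' T[OF i(1)] \<open>i = i'\<close> by simp
    then show "entails ar (regular_identities ar E) s s'"
      using entails_regular_iff[OF E s(1) s'(1)] i i' \<open>i = i'\<close> by simp
  qed
qed

text \<open>Generators of all components are labelled by elements of \<open>J\<close>, so that
  corresponding generators of different components share a label. Indices of type
  \<open>'j set\<close> suffice because finite subsets of \<open>J\<close> realize the free
  semilattice with zero.\<close>

theorem theorem9:
  fixes ar :: "'f \<Rightarrow> nat"
    and E :: "'f identity set"
    and A :: "('f, 'a) algebra"
    and J :: "'j set"
    and a :: "'j \<Rightarrow> 'a"
  assumes plural: "\<exists>f. ar f \<ge> 2"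
    and identities: "\<forall>e\<in>E. is_identity ar e"
    and irregular: "strongly_irregular ar E"
    and A_in_RV: "in_variety ar (regular_identities ar E) A"
  shows "free_on ar (regular_identities ar E) A J a \<longleftrightarrow>
    (\<exists>(S :: ('j set, 'f, 'a) direct_system)
       (\<iota> :: 'j \<Rightarrow> 'j set) (T :: 'j set \<Rightarrow> 'j set) (g :: 'j set \<Rightarrow> 'j \<Rightarrow> 'a).
       semilattice_direct_system ar S \<and> is_plonka_sum ar S A \<and>
       free_semilattice_with_zero (idx S) J \<iota> \<and>
       \<comment> \<open>the generators of \<open>cmp S i\<close> are the \<open>g i j\<close> with \<open>j \<in> T i\<close>\<close>
       (\<forall>i\<in>carrier (idx S). finite (T i) \<and> free_on ar E (cmp S i) (T i) (g i)) \<and>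
       (\<forall>i\<in>carrier (idx S). \<forall>n. card (T i) = n \<longleftrightarrow>
          (\<exists>js. length js = n \<and> distinct js \<and> set js \<subseteq> J \<and>
                i = \<Squnion>\<^bsub>idx S\<^esub> (\<iota> ` set js))) \<and>
       (\<forall>j\<in>J. T (\<iota> j) = {j} \<and> g (\<iota> j) j = a j) \<and>
       (\<forall>i\<in>carrier (idx S).
          is_unique_hom ar (cmp S \<bottom>\<^bsub>idx S\<^esub>) (cmp S i) (trans S \<bottom>\<^bsub>idx S\<^esub> i)) \<and>
       (\<forall>js. js \<noteq> [] \<and> set js \<subseteq> J \<longrightarrow>
          (let i = \<Squnion>\<^bsub>idx S\<^esub> (\<iota> ` set js) in
           \<forall>j\<in>set js. j \<in> T i \<and>
             is_unique_inj_hom_extending ar (cmp S (\<iota> j)) (cmp S i) {j} a (g i)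
               (trans S (\<iota> j) i))) \<and>
       (\<forall>i\<in>carrier (idx S). \<forall>k\<in>carrier (idx S).
          i \<noteq> \<bottom>\<^bsub>idx S\<^esub> \<and> i \<sqsubseteq>\<^bsub>idx S\<^esub> k \<longrightarrow>
          is_unique_inj_hom_extending ar (cmp S i) (cmp S k) (T i) (g i) (g k)
            (trans S i k)))"
proof -
  obtain t where "wf_trm ar t" "vars t = {0, 1}" "variety_satisfies ar E (t, Var 0)"
    using irregular unfolding strongly_irregular_def by (elim exE conjE) (rule that)
  then interpret V: strongly_irregular_variety ar E t
    by (intro strongly_irregular_variety.intro identities)
  show ?thesis (is "?free \<longleftrightarrow> ?sum")
  proof
    assume ?free
    interpret free_regular_algebra ar E t A J a
      by unfold_locales (rule \<open>?free\<close>)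
    \<comment> \<open>The join of singletons is the set of listed elements, so distinct lists for
      \<open>i\<close> are its enumerations. The value \<open>n = 0\<close> corresponds to the empty
      list and the least index.\<close>
    have card: "card i = n \<longleftrightarrow> (\<exists>js. length js = n \<and> distinct js \<and> set js \<subseteq> J \<and>
        i = \<Squnion>\<^bsub>subsets\<^esub> ((\<lambda>j. {j}) ` set js))" if i: "i \<in> Fpow J" for i n
    proof
      assume "card i = n"
      moreover obtain js where "set js = i" "distinct js"
        using finite_distinct_list[of i] i by (auto simp: Fpow_def)
      moreover have "i \<subseteq> J" using i unfolding Fpow_def by blast
      ultimately show "\<exists>js. length js = n \<and> distinct js \<and> set js \<subseteq> J \<and>
        i = \<Squnion>\<^bsub>subsets\<^esub> ((\<lambda>j. {j}) ` set js)"
        using sup_singletons[of js] distinct_card[of js] by (intro exI[of _ js]) simp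
    qed (auto simp: sup_singletons distinct_card)
    \<comment> \<open>This is the general transition map from index \<open>{j}\<close>, where the
      generator is \<open>a j\<close> itself.\<close>
    have ext: "is_unique_inj_hom_extending ar (component {j}) (component i) {j} a (gens i) (fill i)"
      if "i \<in> Fpow J" "j \<in> i" for i j
    proof -
      have j: "j \<in> J" "{j} \<in> Fpow J" using that unfolding Fpow_def by auto
      show ?thesis
        using fill_unique_inj_hom[OF j(2) that(1)] that(2) gens_singleton[OF j(1)]
        unfolding is_unique_inj_hom_extending_def by simp
    qed
    have set_Fpow: "set js \<in> Fpow J" if "set js \<subseteq> J" for js
      using that unfolding Fpow_def by simp
    \<comment> \<open>Here an index is a finite subset of \<open>J\<close> and labels its own
      generators, so \<open>T\<close> is the identity and generators of the semilattice are
      singletons.\<close>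
    show ?sum
      using semilattice_direct_system_system plonka_sum_system free_semilattice_subsets
        free_on_component card gens_singleton fill_unique_hom ext fill_unique_inj_hom set_Fpow
      by (intro exI[of _ system] exI[of _ "\<lambda>j. {j}"] exI[of _ "\<lambda>i. i"] exI[of _ gens] conjI)
        (simp_all add: Let_def bottom_subsets sup_singletons, auto simp: Fpow_def)
  next
    assume ?sum
    then obtain S :: "('j set, 'f, 'a) direct_system" and \<iota> T g where
      sum: "semilattice_direct_system ar S" "is_plonka_sum ar S A"
        "free_semilattice_with_zero (idx S) J \<iota>"
      and free: "\<forall>i\<in>carrier (idx S). finite (T i) \<and> free_on ar E (cmp S i) (T i) (g i)"
      and card: "\<forall>i\<in>carrier (idx S). \<forall>n. card (T i) = n \<longleftrightarrow>
          (\<exists>js. length js = n \<and> distinct js \<and> set js \<subseteq> J \<and> i = \<Squnion>\<^bsub>idx S\<^esub> (\<iota> ` set js))"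
      and single: "\<forall>j\<in>J. T (\<iota> j) = {j} \<and> g (\<iota> j) j = a j"
      and sub: "\<forall>js. js \<noteq> [] \<and> set js \<subseteq> J \<longrightarrow>
          (let i = \<Squnion>\<^bsub>idx S\<^esub> (\<iota> ` set js) in
           \<forall>j\<in>set js. j \<in> T i \<and>
             is_unique_inj_hom_extending ar (cmp S (\<iota> j)) (cmp S i) {j} a (g i)
               (trans S (\<iota> j) i))"
      and ext: "\<forall>i\<in>carrier (idx S). \<forall>k\<in>carrier (idx S).
          i \<noteq> \<bottom>\<^bsub>idx S\<^esub> \<and> i \<sqsubseteq>\<^bsub>idx S\<^esub> k \<longrightarrow>
          is_unique_inj_hom_extending ar (cmp S i) (cmp S k) (T i) (g i) (g k) (trans S i k)"
      by (elim exE conjE) (rule that)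
    show ?free
    proof (rule V.plonka_sum_free[OF A_in_RV sum])
      show "set js \<subseteq> T (\<Squnion>\<^bsub>idx S\<^esub> (\<iota> ` set js))" if "js \<noteq> []" "set js \<subseteq> J" for js
        using sub that unfolding Let_def by blast
      show "trans S i k (g i j) = g k j"
        if "i \<in> carrier (idx S)" "k \<in> carrier (idx S)" "i \<noteq> \<bottom>\<^bsub>idx S\<^esub>" "i \<sqsubseteq>\<^bsub>idx S\<^esub> k" "j \<in> T i"
        for i k j
        using ext that unfolding is_unique_inj_hom_extending_def by blast
    qed (use free card single in blast)+
  qed
qed

end
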